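(* Suppose there is a $t_1(d,n)$-time $c_1$-approximation algorithm $\mathcal{A}_1$ (for some $c_1\ge1$) for the rank aggregation problem, and a $t_2(d)$-time $c_2$-approximation algorithm $\mathcal{A}_2$ (for some $c_2\ge1$) for the colorful bi-partition problem on weighted colored tournaments on $d$ vertices satisfying both the probability and the triangle inequality constraints. Then there exists a $(c_1+c_2)$-approximation algorithm for the fair rank aggregation problem with running time $O(nd^2+t_1(d,n)+t_2(d))$.
   Context: $\mathbb{S}_d$ is the set of rankings of $[d]$; $a\prec_\pi b$ means $a$ precedes $b$ in $\pi$. Kendall tau distance: $\kappa(\pi_1,\pi_2)=|\{(a,b): a\prec_{\pi_1}b,\ b\prec_{\pi_2}a\}|$. For a set $S$ of $n$ rankings, $\mathrm{Obj}(S,\sigma)=\sum_{\pi\in S}\kappa(\pi,\sigma)$. Rank aggregation problem: find $\sigma\in\mathbb{S}_d$ minimizing $\mathrm{Obj}(S,\sigma)$; a $c_1$-approximation outputs $\sigma$ with cost at most $c_1$ times the minimum. Fairness: candidates are partitioned into groups $G_1,\dots,G_g$; for $\bar\alpha,\bar\beta\in[0,1]^g$ and $k\in[d]$, a ranking is $(\bar\alpha,\bar\beta)$-$k$-fair if for every $i$ its top $k$ positions contain at least $\lfloor\alpha_i k\rfloor$ and at most $\lceil\beta_i k\rceil$ candidates of $G_i$. Fair rank aggregation: find an $(\bar\alpha,\bar\beta)$-$k$-fair $\sigma$ minimizing $\mathrm{Obj}(S,\sigma)$; a $c$-approximation outputs an $(\bar\alpha,\bar\beta)$-$k$-fair ranking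 with cost at most $c$ times this minimum. A weighted tournament $T=(V,A)$ has both arcs $(u,v),(v,u)$ for all distinct $u,v$, with nonnegative weights $w$; probability constraints: $w(i,j)+w(j,i)=1$; triangle inequality: $w(i,j)\le w(i,k)+w(k,j)$. With $\mathrm{col}:V\to[g]$, a set $L\subseteq V$ is $(\bar\alpha,\bar\beta)$-colorful if $\lfloor\alpha_i|L|\rfloor\le|L\cap\mathrm{col}^{-1}(i)|\le\lceil\beta_i|L|\rceil$ for all $i$. Colorful bi-partition problem: find $L$ with $|L|=k$, $L$ $(\bar\alpha,\bar\beta)$-colorful, minimizing $\mathrm{cost}(L)=\sum_{(y,x)\in A:\,x\in L,\,y\notin L}w(y,x)$; a $c_2$-approximation outputs a feasible $L$ with cost at most $c_2$ times the minimum. *)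

theory Defs
  imports
    Complex_Main
    "HOL-Library.Disjoint_Sets"
    "HOL-Library.Landau_Symbols"
    "HOL-Combinatorics.Multiset_Permutations"
begin

section \<open>Rankings\<close>

text \<open>A ranking of \<open>[d]\<close> is the list of the candidates \<open>1, \<dots>, d\<close>, from first to last.\<close>

definition rankings :: "nat \<Rightarrow> nat list set" where
  "rankings d = permutations_of_set {1..d}"

definition precedes :: "nat list \<Rightarrow> nat \<Rightarrow> nat \<Rightarrow> bool" where
  "precedes \<pi> a b \<longleftrightarrow> (\<exists>i j. i < j \<and> j < length \<pi> \<and> \<pi> ! i = a \<and> \<pi> ! j = b)"

definition kendall_tau :: "nat list \<Rightarrow> nat list \<Rightarrow> nat" where
  "kendall_tau \<pi>1 \<pi>2 = card {(a, b). precedes \<pi>1 a b \<and> precedes \<pi>2 b a}"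

definition Obj :: "nat list set \<Rightarrow> nat list \<Rightarrow> nat" where
  "Obj S \<sigma> = (\<Sum>\<pi>\<in>S. kendall_tau \<pi> \<sigma>)"

definition group_partition :: "nat \<Rightarrow> nat \<Rightarrow> (nat \<Rightarrow> nat set) \<Rightarrow> bool" where
  "group_partition d g G \<longleftrightarrow> disjoint_family_on G {1..g} \<and> (\<Union>i\<in>{1..g}. G i) = {1..d}"

definition unit_vector_range :: "nat \<Rightarrow> (nat \<Rightarrow> real) \<Rightarrow> bool" where
  "unit_vector_range g \<alpha> \<longleftrightarrow> (\<forall>i\<in>{1..g}. 0 \<le> \<alpha> i \<and> \<alpha> i \<le> 1)"

definition fair ::
  "nat \<Rightarrow> (nat \<Rightarrow> nat set) \<Rightarrow> (nat \<Rightarrow> real) \<Rightarrow> (nat \<Rightarrow> real) \<Rightarrow> nat \<Rightarrow> nat list \<Rightarrow> bool" where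
  "fair g G \<alpha> \<beta> k \<pi> \<longleftrightarrow> (\<forall>i\<in>{1..g}.
     \<lfloor>\<alpha> i * real k\<rfloor> \<le> int (card (set (take k \<pi>) \<inter> G i)) \<and>
     int (card (set (take k \<pi>) \<inter> G i)) \<le> \<lceil>\<beta> i * real k\<rceil>)"

section \<open>Weighted colored tournaments on the vertex set \<open>[d]\<close>\<close>

definition arcs :: "nat \<Rightarrow> (nat \<times> nat) set" where
  "arcs d = {(u, v). u \<in> {1..d} \<and> v \<in> {1..d} \<and> u \<noteq> v}"

definition weighted_tournament :: "nat \<Rightarrow> (nat \<times> nat \<Rightarrow> real) \<Rightarrow> bool" where
  "weighted_tournament d w \<longleftrightarrow> (\<forall>a\<in>arcs d. 0 \<le> w a)"

definition probability_constraints :: "nat \<Rightarrow> (nat \<times> nat \<Rightarrow> real) \<Rightarrow> bool" where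
  "probability_constraints d w \<longleftrightarrow> (\<forall>(i, j)\<in>arcs d. w (i, j) + w (j, i) = 1)"

definition triangle_inequality :: "nat \<Rightarrow> (nat \<times> nat \<Rightarrow> real) \<Rightarrow> bool" where
  "triangle_inequality d w \<longleftrightarrow> (\<forall>i j k. (i, j) \<in> arcs d \<longrightarrow> (i, k) \<in> arcs d \<longrightarrow> (k, j) \<in> arcs d \<longrightarrow>
     w (i, j) \<le> w (i, k) + w (k, j))"

definition colorful ::
  "nat \<Rightarrow> (nat \<Rightarrow> nat) \<Rightarrow> (nat \<Rightarrow> real) \<Rightarrow> (nat \<Rightarrow> real) \<Rightarrow> nat set \<Rightarrow> bool" where
  "colorful g col \<alpha> \<beta> L \<longleftrightarrow> (\<forall>i\<in>{1..g}.
     \<lfloor>\<alpha> i * real (card L)\<rfloor> \<le> int (card (L \<inter> col -` {i})) \<and>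
     int (card (L \<inter> col -` {i})) \<le> \<lceil>\<beta> i * real (card L)\<rceil>)"

definition bipartition_cost :: "nat \<Rightarrow> (nat \<times> nat \<Rightarrow> real) \<Rightarrow> nat set \<Rightarrow> real" where
  "bipartition_cost d w L = (\<Sum>(y, x)\<in>{(y, x). (y, x) \<in> arcs d \<and> x \<in> L \<and> y \<notin> L}. w (y, x))"

section \<open>The real RAM\<close>

text \<open>
  Algorithms are programs of a unit-cost random access machine, presented as a while language over
  finitely many named unbounded arrays. Integer cells serve as data and as addresses; real cells
  hold exact real numbers, which can be combined arithmetically and compared, but not rounded.
  The only numeric literals are integers. A scalar variable is cell 0 of an array.
\<close>

type_synonym state = "(string \<Rightarrow> int \<Rightarrow> int) \<times> (string \<Rightarrow> int \<Rightarrow> real)"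

datatype iexp =
    IConst int
  | ICell string iexp
  | IAdd iexp iexp
  | ISub iexp iexp
  | IMul iexp iexp
  | IDiv iexp iexp

datatype rexp =
    ROfInt iexp
  | RCell string iexp
  | RAdd rexp rexp
  | RSub rexp rexp
  | RMul rexp rexp
  | RDiv rexp rexp

datatype bexp =
    ILess iexp iexp
  | RLess rexp rexp
  | BNot bexp
  | BAnd bexp bexp

datatype com =
    Skip
  | IAssign string iexp iexp
  | RAssign string iexp rexp
  | Seq com com
  | Cond bexp com com
  | While bexp com

primrec ival :: "iexp \<Rightarrow> state \<Rightarrow> int" where
  "ival (IConst c) s = c"
| "ival (ICell x e) s = fst s x (ival e s)"
| "ival (IAdd e f) s = ival e s + ival f s"
| "ival (ISub e f) s = ival e s - ival f s"
| "ival (IMul e f) s = ival e s * ival f s"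
| "ival (IDiv e f) s = ival e s div ival f s"

primrec rval :: "rexp \<Rightarrow> state \<Rightarrow> real" where
  "rval (ROfInt e) s = of_int (ival e s)"
| "rval (RCell x e) s = snd s x (ival e s)"
| "rval (RAdd e f) s = rval e s + rval f s"
| "rval (RSub e f) s = rval e s - rval f s"
| "rval (RMul e f) s = rval e s * rval f s"
| "rval (RDiv e f) s = rval e s / rval f s"

primrec bval :: "bexp \<Rightarrow> state \<Rightarrow> bool" where
  "bval (ILess e f) s \<longleftrightarrow> ival e s < ival f s"
| "bval (RLess e f) s \<longleftrightarrow> rval e s < rval f s"
| "bval (BNot b) s \<longleftrightarrow> \<not> bval b s"
| "bval (BAnd b c) s \<longleftrightarrow> bval b s \<and> bval c s"

text \<open>Evaluating an expression costs one step per operation, constant, and memory access.\<close>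

primrec itime :: "iexp \<Rightarrow> nat" where
  "itime (IConst c) = 1"
| "itime (ICell x e) = 1 + itime e"
| "itime (IAdd e f) = 1 + itime e + itime f"
| "itime (ISub e f) = 1 + itime e + itime f"
| "itime (IMul e f) = 1 + itime e + itime f"
| "itime (IDiv e f) = 1 + itime e + itime f"

primrec rtime :: "rexp \<Rightarrow> nat" where
  "rtime (ROfInt e) = 1 + itime e"
| "rtime (RCell x e) = 1 + itime e"
| "rtime (RAdd e f) = 1 + rtime e + rtime f"
| "rtime (RSub e f) = 1 + rtime e + rtime f"
| "rtime (RMul e f) = 1 + rtime e + rtime f"
| "rtime (RDiv e f) = 1 + rtime e + rtime f"

primrec btime :: "bexp \<Rightarrow> nat" where
  "btime (ILess e f) = 1 + itime e + itime f"
| "btime (RLess e f) = 1 + rtime e + rtime f"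
| "btime (BNot b) = 1 + btime b"
| "btime (BAnd b c) = 1 + btime b + btime c"

text \<open>\<open>exec A s t s'\<close>: started in \<open>s\<close>, the program \<open>A\<close> halts in \<open>s'\<close> after exactly \<open>t\<close> steps.\<close>

inductive exec :: "com \<Rightarrow> state \<Rightarrow> nat \<Rightarrow> state \<Rightarrow> bool" where
  Skip: "exec Skip s 1 s"
| IAssign: "exec (IAssign x i e) s (1 + itime i + itime e)
    ((fst s)(x := (fst s x)(ival i s := ival e s)), snd s)"
| RAssign: "exec (RAssign x i e) s (1 + itime i + rtime e)
    (fst s, (snd s)(x := (snd s x)(ival i s := rval e s)))"
| Seq: "exec A s t s' \<Longrightarrow> exec B s' u s'' \<Longrightarrow> exec (Seq A B) s (t + u) s''"
| CondT: "bval b s \<Longrightarrow> exec A s t s' \<Longrightarrow> exec (Cond b A B) s (1 + btime b + t) s'"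
| CondF: "\<not> bval b s \<Longrightarrow> exec B s t s' \<Longrightarrow> exec (Cond b A B) s (1 + btime b + t) s'"
| WhileF: "\<not> bval b s \<Longrightarrow> exec (While b A) s (1 + btime b) s"
| WhileT: "bval b s \<Longrightarrow> exec A s t s' \<Longrightarrow> exec (While b A) s' u s'' \<Longrightarrow>
    exec (While b A) s (1 + btime b + t + u) s''"

inductive_cases SkipE: "exec Skip s t s'"
inductive_cases IAssignE: "exec (IAssign x i e) s t s'"
inductive_cases RAssignE: "exec (RAssign x i e) s t s'"
inductive_cases SeqE: "exec (Seq A B) s t s'"
inductive_cases CondE: "exec (Cond b A B) s t s'"
inductive_cases WhileE: "exec (While b A) s t s'"

lemma exec_deterministic:
  "exec A s t s' \<Longrightarrow> exec A s u s'' \<Longrightarrow> u = t \<and> s'' = s'"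
proof (induction arbitrary: u s'' rule: exec.induct)
  case (Skip s)
  then show ?case by (auto elim: SkipE)
next
  case (IAssign x i e s)
  then show ?case by (rule IAssignE) simp
next
  case (RAssign x i e s)
  then show ?case by (rule RAssignE) simp
next
  case (Seq A s t s' B u' s3)
  from Seq.prems show ?case
  proof (rule SeqE)
    fix v m w
    assume A: "exec A s v m" and B: "exec B m w s''" and u: "u = v + w"
    from Seq.IH(1)[OF A] have eq: "v = t" "m = s'" by blast+
    from Seq.IH(2)[OF B[unfolded eq]] show ?thesis unfolding u eq by blast
  qed
next
  case (CondT b s A t s' B)
  from CondT.prems show ?case
  proof (rule CondE)
    fix v
    assume A: "exec A s v s''" and u: "u = Suc (btime b + v)"
    from CondT.IH[OF A] have "v = t" "s'' = s'" by blast+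
    then show ?thesis unfolding u by simp
  qed (use CondT.hyps in blast)
next
  case (CondF b s B t s' A)
  from CondF.prems show ?case
  proof (rule CondE)
    fix v
    assume B: "exec B s v s''" and u: "u = Suc (btime b + v)"
    from CondF.IH[OF B] have "v = t" "s'' = s'" by blast+
    then show ?thesis unfolding u by simp
  qed (use CondF.hyps in blast)
next
  case (WhileF b s A)
  from WhileF.prems show ?case by (rule WhileE) (use WhileF.hyps in simp_all)
next
  case (WhileT b s A t s' u' s3)
  from WhileT.prems show ?case
  proof (rule WhileE)
    fix v m w
    assume A: "exec A s v m" and B: "exec (While b A) m w s''" and u: "u = Suc (btime b + v + w)"
    from WhileT.IH(1)[OF A] have eq: "v = t" "m = s'" by blast+
    from WhileT.IH(2)[OF B[unfolded eq]] have "w = u'" "s'' = s3" by blast+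
    then show ?thesis unfolding u eq by simp
  qed (use WhileT.hyps in blast)
qed

section \<open>Encoding of inputs and outputs\<close>

text \<open>
  All cells that are not part of the input are 0. Ranking \<open>i < n\<close> occupies the cells
  \<open>i * d, \<dots>, i * d + d - 1\<close>; the weight of the arc \<open>(u, v)\<close> is in cell \<open>(u - 1) * d + (v - 1)\<close>;
  colors, \<open>\<alpha>\<close> and \<open>\<beta>\<close> are indexed from 1.
\<close>

definition scalar :: "nat \<Rightarrow> int \<Rightarrow> int" where
  "scalar x = (\<lambda>z. if z = 0 then int x else 0)"

definition vector :: "nat \<Rightarrow> (nat \<Rightarrow> 'a::zero) \<Rightarrow> int \<Rightarrow> 'a" where
  "vector m f = (\<lambda>z. if 1 \<le> z \<and> z \<le> int m then f (nat z) else 0)"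

definition ranking_cells :: "nat \<Rightarrow> nat list list \<Rightarrow> int \<Rightarrow> int" where
  "ranking_cells d xs = (\<lambda>z. if 0 \<le> z \<and> z < int (length xs * d)
     then int (xs ! (nat z div d) ! (nat z mod d)) else 0)"

definition weight_cells :: "nat \<Rightarrow> (nat \<times> nat \<Rightarrow> real) \<Rightarrow> int \<Rightarrow> real" where
  "weight_cells d w = (\<lambda>z. if 0 \<le> z \<and> z < int (d * d) \<and> nat z div d \<noteq> nat z mod d
     then w (nat z div d + 1, nat z mod d + 1) else 0)"

definition rank_aggregation_input :: "nat \<Rightarrow> nat list list \<Rightarrow> state" where
  "rank_aggregation_input d xs =
    ((\<lambda>_ _. 0)(''d'' := scalar d, ''n'' := scalar (length xs), ''rankings'' := ranking_cells d xs),
     (\<lambda>_ _. 0))"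

definition fair_rank_aggregation_input ::
  "nat \<Rightarrow> nat list list \<Rightarrow> nat \<Rightarrow> (nat \<Rightarrow> nat set) \<Rightarrow> (nat \<Rightarrow> real) \<Rightarrow> (nat \<Rightarrow> real) \<Rightarrow> nat \<Rightarrow> state" where
  "fair_rank_aggregation_input d xs g G \<alpha> \<beta> k =
    ((\<lambda>_ _. 0)(''d'' := scalar d, ''n'' := scalar (length xs), ''k'' := scalar k, ''g'' := scalar g,
       ''rankings'' := ranking_cells d xs,
       ''group'' := vector d (\<lambda>v. int (THE i. i \<in> {1..g} \<and> v \<in> G i))),
     (\<lambda>_ _. 0)(''alpha'' := vector g \<alpha>, ''beta'' := vector g \<beta>))"

definition bipartition_input ::
  "nat \<Rightarrow> (nat \<times> nat \<Rightarrow> real) \<Rightarrow> nat \<Rightarrow> (nat \<Rightarrow> nat) \<Rightarrow> (nat \<Rightarrow> real) \<Rightarrow> (nat \<Rightarrow> real) \<Rightarrow> nat \<Rightarrow> state" where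
  "bipartition_input d w g col \<alpha> \<beta> k =
    ((\<lambda>_ _. 0)(''d'' := scalar d, ''k'' := scalar k, ''g'' := scalar g,
       ''col'' := vector d (\<lambda>v. int (col v))),
     (\<lambda>_ _. 0)(''w'' := weight_cells d w, ''alpha'' := vector g \<alpha>, ''beta'' := vector g \<beta>))"

definition ranking_output :: "nat \<Rightarrow> state \<Rightarrow> nat list" where
  "ranking_output d s = map (\<lambda>j. nat (fst s ''out'' (int j))) [0..<d]"

definition set_output :: "nat \<Rightarrow> state \<Rightarrow> nat set" where
  "set_output d s = {v \<in> {1..d}. fst s ''out'' (int v) = 1}"

section \<open>Approximation algorithms\<close>

definition approx_solution :: "real \<Rightarrow> 'a set \<Rightarrow> ('a \<Rightarrow> real) \<Rightarrow> 'a \<Rightarrow> bool" where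
  "approx_solution c F cost x \<longleftrightarrow> x \<in> F \<and> cost x \<le> c * Min (cost ` F)"

text \<open>
  A nonempty set \<open>S\<close> of \<open>n\<close> rankings is given to a program by an arbitrary enumeration \<open>xs\<close> without
  repetitions. In the two constrained problems the program has to halt within the time bound on
  every instance, while its output matters only if a feasible solution exists.
\<close>

definition rank_aggregation_algorithm :: "real \<Rightarrow> (nat \<Rightarrow> nat \<Rightarrow> nat) \<Rightarrow> com \<Rightarrow> bool" where
  "rank_aggregation_algorithm c t A \<longleftrightarrow>
    (\<forall>d n S xs. 1 \<le> d \<and> 1 \<le> n \<and> S \<subseteq> rankings d \<and> card S = n \<and> set xs = S \<and> distinct xs \<longrightarrow>
      (\<exists>\<tau> s. exec A (rank_aggregation_input d xs) \<tau> s \<and> \<tau> \<le> t d n \<and>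
        approx_solution c (rankings d) (\<lambda>\<sigma>. real (Obj S \<sigma>)) (ranking_output d s)))"

definition fair_rank_aggregation_algorithm :: "real \<Rightarrow> (nat \<Rightarrow> nat \<Rightarrow> nat) \<Rightarrow> com \<Rightarrow> bool" where
  "fair_rank_aggregation_algorithm c t A \<longleftrightarrow>
    (\<forall>d n S xs g G \<alpha> \<beta> k.
      1 \<le> d \<and> 1 \<le> n \<and> S \<subseteq> rankings d \<and> card S = n \<and> set xs = S \<and> distinct xs \<and>
      group_partition d g G \<and> unit_vector_range g \<alpha> \<and> unit_vector_range g \<beta> \<and> k \<in> {1..d} \<longrightarrow>
      (let F = {\<sigma> \<in> rankings d. fair g G \<alpha> \<beta> k \<sigma>} in
        \<exists>\<tau> s. exec A (fair_rank_aggregation_input d xs g G \<alpha> \<beta> k) \<tau> s \<and> \<tau> \<le> t d n \<and>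
          (F \<noteq> {} \<longrightarrow> approx_solution c F (\<lambda>\<sigma>. real (Obj S \<sigma>)) (ranking_output d s))))"

definition colorful_bipartition_algorithm :: "real \<Rightarrow> (nat \<Rightarrow> nat) \<Rightarrow> com \<Rightarrow> bool" where
  "colorful_bipartition_algorithm c t A \<longleftrightarrow>
    (\<forall>d w g col \<alpha> \<beta> k.
      1 \<le> d \<and> weighted_tournament d w \<and> probability_constraints d w \<and> triangle_inequality d w \<and>
      col ` {1..d} \<subseteq> {1..g} \<and> unit_vector_range g \<alpha> \<and> unit_vector_range g \<beta> \<and> k \<in> {1..d} \<longrightarrow>
      (let F = {L. L \<subseteq> {1..d} \<and> card L = k \<and> colorful g col \<alpha> \<beta> L} in
        \<exists>\<tau> s. exec A (bipartition_input d w g col \<alpha> \<beta> k) \<tau> s \<and> \<tau> \<le> t d \<and>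
          (F \<noteq> {} \<longrightarrow> approx_solution c F (bipartition_cost d w) (set_output d s))))"

end

theory Submission
  imports Defs
begin

text \<open>
  Let \<open>w(a, b)\<close> be the fraction of the input rankings that place \<open>a\<close> before \<open>b\<close>. For every ranking,
  the pairs between its top \<open>k\<close> candidates \<open>L\<close> and the rest contribute exactly \<open>n * cost(L)\<close> to its
  objective. Take a \<open>c1\<close>-approximate ranking \<open>\<sigma>\<close> and a \<open>c2\<close>-approximate colorful set \<open>L\<close> of size
  \<open>k\<close>, and list \<open>L\<close> before its complement, each in the order of \<open>\<sigma>\<close>. The pairs inside the two parts
  cost at most the objective of \<open>\<sigma>\<close>, hence at most \<open>c1 * OPT\<close>; the crossing pairs cost at most
  \<open>c2\<close> times the crossing cost of the top \<open>k\<close> of an optimal fair ranking, hence at most \<open>c2 * OPT\<close>.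
\<close>

section \<open>Rankings and majority tournaments\<close>

lemma precedes_Nil [simp]: "\<not> precedes [] a b"
  by (simp add: precedes_def)

text \<open>This recursion replaces reasoning with indices: the later facts on appending, filtering,
  totality and transitivity follow from it by induction on the list.\<close>

lemma precedes_Cons [simp]:
  "precedes (x # xs) a b \<longleftrightarrow> (x = a \<and> b \<in> set xs) \<or> precedes xs a b"
proof
  assume "precedes (x # xs) a b"
  then obtain i j where ij: "i < j" "j < Suc (length xs)" "(x # xs) ! i = a" "(x # xs) ! j = b"
    by (auto simp: precedes_def)
  then obtain j' where j: "j = Suc j'" by (cases j) auto
  show "(x = a \<and> b \<in> set xs) \<or> precedes xs a b"
  proof (cases i)
    case 0
    then show ?thesis using ij j by auto
  next
    case (Suc i')
    then show ?thesis using ij j unfolding precedes_def by auto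
  qed
next
  assume "(x = a \<and> b \<in> set xs) \<or> precedes xs a b"
  then show "precedes (x # xs) a b"
  proof
    assume "x = a \<and> b \<in> set xs"
    then obtain j where "j < length xs" "xs ! j = b" "x = a" by (auto simp: in_set_conv_nth)
    then have "0 < Suc j \<and> Suc j < length (x # xs) \<and> (x # xs) ! 0 = a \<and> (x # xs) ! Suc j = b"
      by simp
    then show ?thesis unfolding precedes_def by blast
  next
    assume "precedes xs a b"
    then obtain i j where "i < j" "j < length xs" "xs ! i = a" "xs ! j = b"
      by (auto simp: precedes_def)
    then have "Suc i < Suc j \<and> Suc j < length (x # xs) \<and> (x # xs) ! Suc i = a \<and> (x # xs) ! Suc j = b"
      by simp
    then show ?thesis unfolding precedes_def by blast
  qed
qed

lemma precedes_append [simp]: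
  "precedes (xs @ ys) a b \<longleftrightarrow> precedes xs a b \<or> precedes ys a b \<or> (a \<in> set xs \<and> b \<in> set ys)"
  by (induction xs) auto

lemma precedes_in_set: "precedes xs a b \<Longrightarrow> a \<in> set xs \<and> b \<in> set xs"
  by (induction xs) auto

lemma precedes_filter [simp]:
  "precedes (filter P xs) a b \<longleftrightarrow> P a \<and> P b \<and> precedes xs a b"
  by (induction xs) auto

lemma precedes_total: "a \<in> set xs \<Longrightarrow> b \<in> set xs \<Longrightarrow> a \<noteq> b \<Longrightarrow> precedes xs a b \<or> precedes xs b a"
  by (induction xs) auto

lemma precedes_asym: "distinct xs \<Longrightarrow> precedes xs a b \<Longrightarrow> \<not> precedes xs b a"
  by (induction xs) (auto dest: precedes_in_set)

lemma precedes_trans: "distinct xs \<Longrightarrow> precedes xs a b \<Longrightarrow> precedes xs b c \<Longrightarrow> precedes xs a c"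
  by (induction xs) (auto dest: precedes_in_set)

lemma rankingsD:
  assumes "\<pi> \<in> rankings d"
  shows "distinct \<pi>" "set \<pi> = {1..d}" "length \<pi> = d"
proof -
  show 1: "distinct \<pi>" "set \<pi> = {1..d}"
    using assms by (auto simp: rankings_def permutations_of_set_def)
  show "length \<pi> = d" using distinct_card[OF 1(1)] 1(2) by simp
qed

lemma rankingsI: "distinct \<pi> \<Longrightarrow> set \<pi> = {1..d} \<Longrightarrow> \<pi> \<in> rankings d"
  by (simp add: rankings_def permutations_of_set_def)

lemma finite_rankings [simp]: "finite (rankings d)"
  by (simp add: rankings_def)

lemma finite_precedes: "finite {(a, b). precedes xs a b \<and> P a b}"
  by (rule finite_subset[of _ "set xs \<times> set xs"]) (auto dest: precedes_in_set)

lemma finite_arcs [simp]: "finite (arcs d)"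
  by (rule finite_subset[of _ "{1..d} \<times> {1..d}"]) (auto simp: arcs_def)

section \<open>The majority tournament, its two constraints and its bipartition cost\<close>

definition majority_weight :: "nat list set \<Rightarrow> nat \<times> nat \<Rightarrow> real" where
  "majority_weight S = (\<lambda>(a, b). real (card {\<pi> \<in> S. precedes \<pi> a b}) / real (card S))"

text \<open>The index set of \<open>bipartition_cost\<close>. Whenever an input ranking puts
  \<open>y\<close> before \<open>x\<close>, such a pair is inverted by every ranking with
  \<open>L\<close> on top.\<close>

definition crossing_arcs :: "nat \<Rightarrow> nat set \<Rightarrow> (nat \<times> nat) set" where
  "crossing_arcs d L = {(y, x). (y, x) \<in> arcs d \<and> x \<in> L \<and> y \<notin> L}"

lemma finite_crossing_arcs [simp]: "finite (crossing_arcs d L)"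
  by (rule finite_subset[of _ "arcs d"]) (auto simp: crossing_arcs_def)

lemma majority_weighted_tournament: "weighted_tournament d (majority_weight S)"
  by (auto simp: weighted_tournament_def majority_weight_def)

text \<open>Every ranking orders two distinct candidates in exactly one way, so \<open>S\<close>
  splits into two disjoint sets whose sizes add up to \<open>card S\<close>.\<close>

lemma majority_probability_constraints:
  assumes S: "S \<subseteq> rankings d" and ne: "S \<noteq> {}"
  shows "probability_constraints d (majority_weight S)"
  unfolding probability_constraints_def
proof clarify
  fix a b assume ab: "(a, b) \<in> arcs d"
  have fin: "finite S" using S by (rule finite_subset) simp
  have "S = {\<pi> \<in> S. precedes \<pi> a b} \<union> {\<pi> \<in> S. precedes \<pi> b a}"
    using precedes_total[of a _ b] ab S rankingsD(2) unfolding arcs_def by blast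
  moreover have "{\<pi> \<in> S. precedes \<pi> a b} \<inter> {\<pi> \<in> S. precedes \<pi> b a} = {}"
    using precedes_asym S rankingsD(1) by blast
  ultimately have "card S = card {\<pi> \<in> S. precedes \<pi> a b} + card {\<pi> \<in> S. precedes \<pi> b a}"
    using fin by (metis (no_types, lifting) card_Un_disjoint finite_Un)
  moreover have "card S > 0" using fin ne by (simp add: card_gt_0_iff)
  ultimately show "majority_weight S (a, b) + majority_weight S (b, a) = 1"
    by (simp add: majority_weight_def field_simps flip: of_nat_add)
qed

text \<open>A ranking with \<open>a\<close> before \<open>b\<close> has \<open>a\<close> before
  \<open>c\<close> or \<open>c\<close> before \<open>b\<close>: otherwise \<open>c\<close> comes
  before \<open>a\<close>, and transitivity puts it before \<open>b\<close>. The inequality thus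
  holds ranking by ranking.\<close>

lemma majority_triangle_inequality:
  assumes S: "S \<subseteq> rankings d"
  shows "triangle_inequality d (majority_weight S)"
  unfolding triangle_inequality_def
proof (intro allI impI)
  fix a b c assume arcs: "(a, b) \<in> arcs d" "(a, c) \<in> arcs d" "(c, b) \<in> arcs d"
  have fin: "finite S" using S by (rule finite_subset) simp
  have "{\<pi> \<in> S. precedes \<pi> a b} \<subseteq> {\<pi> \<in> S. precedes \<pi> a c} \<union> {\<pi> \<in> S. precedes \<pi> c b}"
  proof clarify
    fix \<pi> assume p: "\<pi> \<in> S" "precedes \<pi> a b" "\<not> precedes \<pi> c b"
    then have r: "\<pi> \<in> rankings d" using S by auto
    then show "precedes \<pi> a c"
      using p arcs precedes_total[of a \<pi> c] precedes_trans[of \<pi> c a b] rankingsD[OF r]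
      by (auto simp: arcs_def)
  qed
  then have "card {\<pi> \<in> S. precedes \<pi> a b}
      \<le> card ({\<pi> \<in> S. precedes \<pi> a c} \<union> {\<pi> \<in> S. precedes \<pi> c b})"
    using fin by (intro card_mono) auto
  also have "\<dots> \<le> card {\<pi> \<in> S. precedes \<pi> a c} + card {\<pi> \<in> S. precedes \<pi> c b}"
    by (rule card_Un_le)
  finally show "majority_weight S (a, b) \<le> majority_weight S (a, c) + majority_weight S (c, b)"
    by (simp add: majority_weight_def divide_right_mono flip: add_divide_distrib of_nat_add)
qed

text \<open>Double counting of the pairs of a crossing arc and a ranking that agrees with it; the
  factor \<open>card S\<close> cancels the normalisation of the weights.\<close>

lemma card_times_bipartition_cost:
  assumes fin: "finite S" and ne: "S \<noteq> {}"
  shows "real (card S) * bipartition_cost d (majority_weight S) L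
    = real (\<Sum>\<pi>\<in>S. card {(y, x) \<in> crossing_arcs d L. precedes \<pi> y x})"
proof -
  have n: "card S > 0" using assms by (simp add: card_gt_0_iff)
  have "real (card S) * bipartition_cost d (majority_weight S) L
    = real (\<Sum>e\<in>crossing_arcs d L. card {\<pi> \<in> S. precedes \<pi> (fst e) (snd e)})"
    unfolding bipartition_cost_def crossing_arcs_def[symmetric] using n
    by (auto simp: sum_distrib_left majority_weight_def intro!: sum.cong)
  also have "(\<Sum>e\<in>crossing_arcs d L. card {\<pi> \<in> S. precedes \<pi> (fst e) (snd e)})
    = (\<Sum>\<pi>\<in>S. card {e \<in> crossing_arcs d L. precedes \<pi> (fst e) (snd e)})"
    by (rule sum_multicount_gen) (auto simp: fin)
  finally show ?thesis by (simp add: case_prod_unfold)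
qed

section \<open>Promoting a set of candidates, and the approximation ratio\<close>

definition promote :: "nat set \<Rightarrow> nat list \<Rightarrow> nat list" where
  "promote L \<sigma> = filter (\<lambda>v. v \<in> L) \<sigma> @ filter (\<lambda>v. v \<notin> L) \<sigma>"

lemma promote_in_rankings: "\<sigma> \<in> rankings d \<Longrightarrow> promote L \<sigma> \<in> rankings d"
  by (rule rankingsI) (auto simp: promote_def dest: rankingsD)

lemma set_take_promote:
  assumes "\<sigma> \<in> rankings d" and "L \<subseteq> {1..d}"
  shows "set (take (card L) (promote L \<sigma>)) = L"
proof -
  have s: "set (filter (\<lambda>v. v \<in> L) \<sigma>) = L"
    using assms rankingsD(2) by auto
  moreover have "distinct (filter (\<lambda>v. v \<in> L) \<sigma>)" using assms rankingsD(1) by simp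
  ultimately have "length (filter (\<lambda>v. v \<in> L) \<sigma>) = card L"
    using distinct_card by metis
  then show ?thesis using s by (simp add: promote_def)
qed

text \<open>A pair inverted by the promoted list either lies inside one part, where the order of
  \<open>\<sigma>\<close> is kept and \<open>\<sigma>\<close> inverts it too, or it leads from
  outside \<open>L\<close> into \<open>L\<close> and is a crossing arc that the input ranking
  follows.\<close>

lemma Obj_promote_le:
  assumes S: "S \<subseteq> rankings d" and ne: "S \<noteq> {}"
  shows "real (Obj S (promote L \<sigma>))
    \<le> real (Obj S \<sigma>) + real (card S) * bipartition_cost d (majority_weight S) L"
proof -
  have "kendall_tau \<pi> (promote L \<sigma>)
      \<le> kendall_tau \<pi> \<sigma> + card {(y, x) \<in> crossing_arcs d L. precedes \<pi> y x}"
    if "\<pi> \<in> S" for \<pi>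
  proof -
    have r: "\<pi> \<in> rankings d" using that S by auto
    have "{(a, b). precedes \<pi> a b \<and> precedes (promote L \<sigma>) b a}
      \<subseteq> {(a, b). precedes \<pi> a b \<and> precedes \<sigma> b a}
        \<union> {(y, x) \<in> crossing_arcs d L. precedes \<pi> y x}"
      using rankingsD[OF r]
      by (auto simp: promote_def crossing_arcs_def arcs_def dest: precedes_in_set)
    then have "kendall_tau \<pi> (promote L \<sigma>)
      \<le> card ({(a, b). precedes \<pi> a b \<and> precedes \<sigma> b a}
        \<union> {(y, x) \<in> crossing_arcs d L. precedes \<pi> y x})"
      unfolding kendall_tau_def
      by (intro card_mono finite_UnI finite_precedes)
        (auto intro: finite_subset[of _ "crossing_arcs d L"])
    also have "\<dots> \<le> kendall_tau \<pi> \<sigma> + card {(y, x) \<in> crossing_arcs d L. precedes \<pi> y x}"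
      unfolding kendall_tau_def by (rule card_Un_le)
    finally show ?thesis .
  qed
  then have "Obj S (promote L \<sigma>)
      \<le> Obj S \<sigma> + (\<Sum>\<pi>\<in>S. card {(y, x) \<in> crossing_arcs d L. precedes \<pi> y x})"
    unfolding Obj_def sum.distrib[symmetric] by (rule sum_mono)
  moreover have "finite S" using S by (rule finite_subset) simp
  ultimately show ?thesis
    using card_times_bipartition_cost[OF _ ne, of d L] by (simp del: of_nat_sum flip: of_nat_add)
qed

text \<open>\<open>\<tau>\<close> puts each of its top \<open>k\<close> candidates before each
  remaining one, so every crossing arc followed by an input ranking is an inversion between that
  ranking and \<open>\<tau>\<close>.\<close>

lemma bipartition_cost_top_le_Obj:
  assumes S: "S \<subseteq> rankings d" and ne: "S \<noteq> {}" and t: "\<tau> \<in> rankings d"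
  shows "real (card S) * bipartition_cost d (majority_weight S) (set (take k \<tau>)) \<le> real (Obj S \<tau>)"
proof -
  let ?L = "set (take k \<tau>)"
  have "precedes \<tau> x y" if "(y, x) \<in> crossing_arcs d ?L" for x y
  proof -
    have "x \<in> ?L" "y \<notin> ?L" "y \<in> set \<tau>"
      using that rankingsD(2)[OF t] by (auto simp: crossing_arcs_def arcs_def)
    moreover have "set \<tau> = ?L \<union> set (drop k \<tau>)" by (metis append_take_drop_id set_append)
    ultimately show ?thesis using precedes_append[of "take k \<tau>" "drop k \<tau>" x y] by auto
  qed
  then have "card {(y, x) \<in> crossing_arcs d ?L. precedes \<pi> y x} \<le> kendall_tau \<pi> \<tau>" for \<pi>
    unfolding kendall_tau_def by (intro card_mono finite_precedes) auto
  then have "(\<Sum>\<pi>\<in>S. card {(y, x) \<in> crossing_arcs d ?L. precedes \<pi> y x}) \<le> Obj S \<tau>"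
    unfolding Obj_def by (intro sum_mono) auto
  moreover have "finite S" using S by (rule finite_subset) simp
  ultimately show ?thesis
    using card_times_bipartition_cost[OF _ ne, of d ?L] by (simp del: of_nat_sum)
qed

lemma fair_iff_colorful:
  assumes G: "group_partition d g G" and \<pi>: "\<pi> \<in> rankings d" and k: "k \<le> d"
  shows "fair g G \<alpha> \<beta> k \<pi> \<longleftrightarrow>
    colorful g (\<lambda>v. THE i. i \<in> {1..g} \<and> v \<in> G i) \<alpha> \<beta> (set (take k \<pi>))"
proof -
  let ?col = "\<lambda>v. THE i. i \<in> {1..g} \<and> v \<in> G i"
  have col: "?col v = i" if "v \<in> G i" "i \<in> {1..g}" for v i
    using that G unfolding group_partition_def disjoint_family_on_def
    by (intro the_equality) blast+
  \<comment> \<open>The equality is claimed only on the top candidates: outside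
    \<open>{1..d}\<close> the description \<open>?col\<close> need not single out a group, so a
    colour class may contain numbers that belong to no group.\<close>
  have "set (take k \<pi>) \<inter> G i = set (take k \<pi>) \<inter> ?col -` {i}" if i: "i \<in> {1..g}" for i
  proof -
    have "v \<in> G i" if v: "v \<in> set (take k \<pi>)" "?col v = i" for v
    proof -
      have "v \<in> {1..d}" using v rankingsD(2)[OF \<pi>] set_take_subset by fastforce
      then obtain i' where "i' \<in> {1..g}" "v \<in> G i'" using G unfolding group_partition_def by blast
      then show ?thesis using col v by auto
    qed
    then show ?thesis using col i by auto
  qed
  moreover have "card (set (take k \<pi>)) = k"
    using rankingsD[OF \<pi>] k by (simp add: distinct_card)
  ultimately show ?thesis by (simp add: fair_def colorful_def)
qed

text \<open>The guarantee for \<open>L\<close> is conditional because a bipartition program promises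
  nothing about its output on infeasible instances; an optimal fair ranking supplies the feasible
  set that triggers it.\<close>

lemma approx_solution_promote:
  assumes S: "S \<subseteq> rankings d" and ne: "S \<noteq> {}" and G: "group_partition d g G"
    and k: "k \<le> d" and c1: "0 \<le> c1" and c2: "0 \<le> c2"
    and F: "F = {\<sigma> \<in> rankings d. fair g G \<alpha> \<beta> k \<sigma>}"
    and F': "F' = {L. L \<subseteq> {1..d} \<and> card L = k \<and>
      colorful g (\<lambda>v. THE i. i \<in> {1..g} \<and> v \<in> G i) \<alpha> \<beta> L}"
    and nonempty: "F \<noteq> {}"
    and \<sigma>: "approx_solution c1 (rankings d) (\<lambda>\<sigma>. real (Obj S \<sigma>)) \<sigma>"
    and L: "F' \<noteq> {} \<Longrightarrow> approx_solution c2 F' (bipartition_cost d (majority_weight S)) L"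
  shows "approx_solution (c1 + c2) F (\<lambda>\<sigma>. real (Obj S \<sigma>)) (promote L \<sigma>)"
proof -
  let ?cost = "bipartition_cost d (majority_weight S)" and ?obj = "\<lambda>\<sigma>. real (Obj S \<sigma>)"
  have finF: "finite F" by (simp add: F)
  have "F' \<subseteq> Pow {1..d}" by (auto simp: F')
  then have finF': "finite F'" by (rule finite_subset) simp
  have \<sigma>r: "\<sigma> \<in> rankings d" using \<sigma> by (simp add: approx_solution_def)
  have "Min (?obj ` F) \<in> ?obj ` F" using finF nonempty by (intro Min_in) auto
  \<comment> \<open>The optimal fair ranking \<open>\<tau>\<close> has two roles: its objective
    bounds the unconstrained optimum, and its top \<open>k\<close> candidates form the feasible set
    against which \<open>L\<close> is measured.\<close>
  then obtain \<tau> where \<tau>: "\<tau> \<in> F" and opt: "Min (?obj ` F) = ?obj \<tau>" by auto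
  have \<tau>r: "\<tau> \<in> rankings d" using \<tau> F by auto
  have "card (set (take k \<tau>)) = k" using rankingsD[OF \<tau>r] k by (simp add: distinct_card)
  moreover have "set (take k \<tau>) \<subseteq> {1..d}" using rankingsD(2)[OF \<tau>r] set_take_subset by fastforce
  ultimately have top: "set (take k \<tau>) \<in> F'"
    using \<tau> fair_iff_colorful[OF G \<tau>r k] by (simp add: F F')
  then have L': "approx_solution c2 F' ?cost L" using L by blast
  then have LF: "L \<subseteq> {1..d}" "card L = k" "colorful g (\<lambda>v. THE i. i \<in> {1..g} \<and> v \<in> G i) \<alpha> \<beta> L"
    by (auto simp: approx_solution_def F')
  have "promote L \<sigma> \<in> F"
    using promote_in_rankings[OF \<sigma>r] fair_iff_colorful[OF G promote_in_rankings[OF \<sigma>r] k]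
      set_take_promote[OF \<sigma>r LF(1)] LF by (simp add: F)
  moreover have "?obj (promote L \<sigma>) \<le> (c1 + c2) * ?obj \<tau>"
  proof -
    have "?obj \<sigma> \<le> c1 * Min (?obj ` rankings d)" using \<sigma> by (simp add: approx_solution_def)
    also have "\<dots> \<le> c1 * ?obj \<tau>" using c1 \<tau>r by (intro mult_left_mono Min_le) auto
    finally have 1: "?obj \<sigma> \<le> c1 * ?obj \<tau>" .
    have "?cost L \<le> c2 * Min (?cost ` F')" using L' by (simp add: approx_solution_def)
    also have "\<dots> \<le> c2 * ?cost (set (take k \<tau>))"
      using c2 top finF' by (intro mult_left_mono Min_le) auto
    finally have "real (card S) * ?cost L \<le> c2 * (real (card S) * ?cost (set (take k \<tau>)))"
      by (metis mult_left_mono mult.left_commute of_nat_0_le_iff)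
    also have "\<dots> \<le> c2 * ?obj \<tau>"
      using c2 bipartition_cost_top_le_Obj[OF S ne \<tau>r] by (intro mult_left_mono) auto
    finally show ?thesis using 1 Obj_promote_le[OF S ne, of L \<sigma>] by (simp add: distrib_right)
  qed
  ultimately show ?thesis using opt by (simp add: approx_solution_def)
qed

section \<open>Renaming arrays\<close>

primrec rename_iexp :: "(string \<Rightarrow> string) \<Rightarrow> iexp \<Rightarrow> iexp" where
  "rename_iexp f (IConst c) = IConst c"
| "rename_iexp f (ICell x e) = ICell (f x) (rename_iexp f e)"
| "rename_iexp f (IAdd e e') = IAdd (rename_iexp f e) (rename_iexp f e')"
| "rename_iexp f (ISub e e') = ISub (rename_iexp f e) (rename_iexp f e')"
| "rename_iexp f (IMul e e') = IMul (rename_iexp f e) (rename_iexp f e')"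
| "rename_iexp f (IDiv e e') = IDiv (rename_iexp f e) (rename_iexp f e')"

primrec rename_rexp :: "(string \<Rightarrow> string) \<Rightarrow> rexp \<Rightarrow> rexp" where
  "rename_rexp f (ROfInt e) = ROfInt (rename_iexp f e)"
| "rename_rexp f (RCell x e) = RCell (f x) (rename_iexp f e)"
| "rename_rexp f (RAdd e e') = RAdd (rename_rexp f e) (rename_rexp f e')"
| "rename_rexp f (RSub e e') = RSub (rename_rexp f e) (rename_rexp f e')"
| "rename_rexp f (RMul e e') = RMul (rename_rexp f e) (rename_rexp f e')"
| "rename_rexp f (RDiv e e') = RDiv (rename_rexp f e) (rename_rexp f e')"

primrec rename_bexp :: "(string \<Rightarrow> string) \<Rightarrow> bexp \<Rightarrow> bexp" where
  "rename_bexp f (ILess e e') = ILess (rename_iexp f e) (rename_iexp f e')"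
| "rename_bexp f (RLess e e') = RLess (rename_rexp f e) (rename_rexp f e')"
| "rename_bexp f (BNot b) = BNot (rename_bexp f b)"
| "rename_bexp f (BAnd b c) = BAnd (rename_bexp f b) (rename_bexp f c)"

primrec rename_com :: "(string \<Rightarrow> string) \<Rightarrow> com \<Rightarrow> com" where
  "rename_com f Skip = Skip"
| "rename_com f (IAssign x i e) = IAssign (f x) (rename_iexp f i) (rename_iexp f e)"
| "rename_com f (RAssign x i e) = RAssign (f x) (rename_iexp f i) (rename_rexp f e)"
| "rename_com f (Seq A B) = Seq (rename_com f A) (rename_com f B)"
| "rename_com f (Cond b A B) = Cond (rename_bexp f b) (rename_com f A) (rename_com f B)"
| "rename_com f (While b A) = While (rename_bexp f b) (rename_com f A)"

text \<open>The part of a state that a renamed program sees, presented under the original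
  names.\<close>

definition pull :: "(string \<Rightarrow> string) \<Rightarrow> state \<Rightarrow> state" where
  "pull f s = (\<lambda>x. fst s (f x), \<lambda>x. snd s (f x))"

text \<open>The frame condition for a program that writes only to arrays named in
  \<open>X\<close>.\<close>

definition agree_off :: "string set \<Rightarrow> state \<Rightarrow> state \<Rightarrow> bool" where
  "agree_off X s s' \<longleftrightarrow> (\<forall>x. x \<notin> X \<longrightarrow> fst s' x = fst s x \<and> snd s' x = snd s x)"

lemma agree_off_refl: "agree_off X s s"
  by (simp add: agree_off_def)

lemma agree_off_trans: "agree_off X s s' \<Longrightarrow> agree_off X s' s'' \<Longrightarrow> agree_off X s s''"
  by (simp add: agree_off_def)

lemma pull_agree_off:
  "agree_off X s s' \<Longrightarrow> range f \<inter> X = {} \<Longrightarrow> pull f s' = pull f s"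
  by (auto simp: agree_off_def pull_def fun_eq_iff)

lemma ival_rename [simp]: "ival (rename_iexp f e) s = ival e (pull f s)"
  by (induction e) (auto simp: pull_def)

lemma rval_rename [simp]: "rval (rename_rexp f e) s = rval e (pull f s)"
  by (induction e) (auto simp: pull_def)

lemma bval_rename [simp]: "bval (rename_bexp f b) s = bval b (pull f s)"
  by (induction b) auto

lemma itime_rename [simp]: "itime (rename_iexp f e) = itime e"
  by (induction e) auto

lemma rtime_rename [simp]: "rtime (rename_rexp f e) = rtime e"
  by (induction e) auto

lemma btime_rename [simp]: "btime (rename_bexp f b) = btime b"
  by (induction b) auto

text \<open>This lets a given program run as a subroutine on its own family of arrays. By
  injectivity, a write to a renamed array changes only the matching array of the pulled state; the
  step count is the same because renaming preserves expression times.\<close>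

lemma exec_rename:
  assumes "exec A (pull f s) t s1" and inj: "inj f"
  shows "\<exists>s'. exec (rename_com f A) s t s' \<and> pull f s' = s1 \<and> agree_off (range f) s s'"
proof -
  \<comment> \<open>The pulled initial state is generalised to a variable \<open>s0\<close> for rule
    induction on \<open>exec\<close>.\<close>
  have "\<exists>s'. exec (rename_com f A) s t s' \<and> pull f s' = s1 \<and> agree_off (range f) s s'"
    if "exec A s0 t s1" "pull f s = s0" for A s0 t s1 s
    using that
  proof (induction arbitrary: s rule: exec.induct)
    case (Skip s0)
    show ?case using exec.Skip[of s] Skip agree_off_refl[of "range f" s] by fastforce
  next
    case (IAssign x i e s0)
    show ?case
      using exec.IAssign[of "f x" "rename_iexp f i" "rename_iexp f e" s] IAssign inj
      by (intro exI conjI, simp) (auto simp: pull_def agree_off_def fun_eq_iff inj_eq)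
  next
    case (RAssign x i e s0)
    show ?case
      using exec.RAssign[of "f x" "rename_iexp f i" "rename_rexp f e" s] RAssign inj
      by (intro exI conjI, simp) (auto simp: pull_def agree_off_def fun_eq_iff inj_eq)
  next
    case (Seq A s0 t s' B u s'')
    then obtain s2 where s2: "exec (rename_com f A) s t s2" "pull f s2 = s'" "agree_off (range f) s s2"
      by blast
    with Seq obtain s3 where "exec (rename_com f B) s2 u s3" "pull f s3 = s''"
      "agree_off (range f) s2 s3" by blast
    then show ?case
      using exec.Seq[OF s2(1)] agree_off_trans[OF s2(3)] unfolding rename_com.simps by blast
  next
    case (CondT b s0 A t s' B)
    then obtain s2 where "exec (rename_com f A) s t s2" "pull f s2 = s'" "agree_off (range f) s s2"
      by blast
    moreover have "exec (rename_com f (Cond b A B)) s (1 + btime b + t) s2"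
      using exec.CondT[of "rename_bexp f b" s "rename_com f A" t s2] CondT calculation by simp
    ultimately show ?case by blast
  next
    case (CondF b s0 B t s' A)
    then obtain s2 where "exec (rename_com f B) s t s2" "pull f s2 = s'" "agree_off (range f) s s2"
      by blast
    moreover have "exec (rename_com f (Cond b A B)) s (1 + btime b + t) s2"
      using exec.CondF[of "rename_bexp f b" s "rename_com f B" t s2] CondF calculation by simp
    ultimately show ?case by blast
  next
    case (WhileF b s0 A)
    then show ?case
      using exec.WhileF[of "rename_bexp f b" s "rename_com f A"] agree_off_refl[of "range f" s]
      by fastforce
  next
    case (WhileT b s0 A t s' u s'')
    then obtain s2 where s2: "exec (rename_com f A) s t s2" "pull f s2 = s'" "agree_off (range f) s s2"
      by blast
    with WhileT obtain s3 where "exec (rename_com f (While b A)) s2 u s3" "pull f s3 = s''"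
      "agree_off (range f) s2 s3" by blast
    moreover have "exec (rename_com f (While b A)) s (1 + btime b + t + u) s3"
      using exec.WhileT[of "rename_bexp f b" s "rename_com f A" t s2 u s3] WhileT s2 calculation
      by simp
    ultimately show ?case using agree_off_trans[OF s2(3)] by blast
  qed
  then show ?thesis using assms(1) by blast
qed

section \<open>Loops\<close>

abbreviation var :: "string \<Rightarrow> iexp" where
  "var x \<equiv> ICell x (IConst 0)"

text \<open>Every loop counts in cell 0 of the same array \<open>''t''\<close>, so loops can be
  sequenced but not nested; the bound \<open>e\<close> is evaluated anew at each test.\<close>

definition for_loop :: "iexp \<Rightarrow> com \<Rightarrow> com" where
  "for_loop e body = Seq (IAssign ''t'' (IConst 0) (IConst 0))
    (While (ILess (var ''t'') e) (Seq body (IAssign ''t'' (IConst 0) (IAdd (var ''t'') (IConst 1)))))"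

definition set_counter :: "int \<Rightarrow> state \<Rightarrow> state" where
  "set_counter v s = ((fst s)(''t'' := (fst s ''t'')(0 := v)), snd s)"

text \<open>An invariant rule: \<open>I j\<close> describes the state at the loop test after
  \<open>j\<close> rounds, and the increment of the counter is folded into the step condition
  through \<open>set_counter\<close>.\<close>

lemma exec_for_loop:
  assumes init: "I 0 (set_counter 0 s)"
    and step: "\<And>j s. j < m \<Longrightarrow> I j s \<Longrightarrow>
      \<exists>\<tau> s'. exec body s \<tau> s' \<and> \<tau> \<le> B \<and> I (Suc j) (set_counter (fst s' ''t'' 0 + 1) s')"
    and bound: "\<And>j s. j \<le> m \<Longrightarrow> I j s \<Longrightarrow> ival e s = int m \<and> fst s ''t'' 0 = int j"
  shows "\<exists>\<tau> s'. exec (for_loop e body) s \<tau> s' \<and> \<tau> \<le> (m + 1) * (B + itime e + 10) \<and> I m s'"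
proof -
  let ?inc = "IAssign ''t'' (IConst 0) (IAdd (var ''t'') (IConst 1))"
  let ?W = "While (ILess (var ''t'') e) (Seq body ?inc)"
  \<comment> \<open>\<open>r\<close> counts the remaining rounds. A round costs
    \<open>itime e + 4\<close> for the test, at most \<open>B\<close> for the body and 6 for the
    increment; the final \<open>itime e + 4\<close> pays for the failing test.\<close>
  have loop: "\<exists>\<tau> s'. exec ?W s \<tau> s' \<and> \<tau> \<le> r * (B + itime e + 10) + itime e + 4 \<and> I m s'"
    if "I j s" "j + r = m" for r j s
    using that
  proof (induction r arbitrary: j s)
    case 0
    then have "exec ?W s (1 + btime (ILess (var ''t'') e)) s"
      using bound[of j s] by (intro exec.WhileF) simp
    then show ?case using 0 by (intro exI[of _ s] exI conjI) auto
  next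
    case (Suc r)
    then obtain \<tau> s' where b: "exec body s \<tau> s'" "\<tau> \<le> B"
      and I: "I (Suc j) (set_counter (fst s' ''t'' 0 + 1) s')"
      using step[of j s] by auto
    have "exec ?inc s' 6 (set_counter (fst s' ''t'' 0 + 1) s')"
      using exec.IAssign[of "''t''" "IConst 0" "IAdd (var ''t'') (IConst 1)" s']
      by (simp add: set_counter_def eval_nat_numeral)
    then have body: "exec (Seq body ?inc) s (\<tau> + 6) (set_counter (fst s' ''t'' 0 + 1) s')"
      using b by (intro exec.Seq)
    obtain \<tau>' s'' where "exec ?W (set_counter (fst s' ''t'' 0 + 1) s') \<tau>' s''"
      and t: "\<tau>' \<le> r * (B + itime e + 10) + itime e + 4" and "I m s''"
      using Suc.IH[OF I] Suc.prems by auto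
    moreover have "bval (ILess (var ''t'') e) s" using bound[of j s] Suc.prems by auto
    ultimately have "exec ?W s (1 + btime (ILess (var ''t'') e) + (\<tau> + 6) + \<tau>') s''"
      using body by (intro exec.WhileT)
    moreover have "1 + btime (ILess (var ''t'') e) + (\<tau> + 6) + \<tau>'
        \<le> Suc r * (B + itime e + 10) + itime e + 4"
      using t b by simp
    ultimately show ?case using \<open>I m s''\<close> by blast
  qed
  obtain \<tau> s' where w: "exec ?W (set_counter 0 s) \<tau> s'"
    "\<tau> \<le> m * (B + itime e + 10) + itime e + 4" "I m s'"
    using loop[OF init, of m] by auto
  have "exec (IAssign ''t'' (IConst 0) (IConst 0)) s 3 (set_counter 0 s)"
    using exec.IAssign[of "''t''" "IConst 0" "IConst 0" s]
    by (simp add: set_counter_def eval_nat_numeral)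
  then have "exec (for_loop e body) s (3 + \<tau>) s'"
    unfolding for_loop_def using w by (intro exec.Seq)
  moreover have "3 + \<tau> \<le> (m + 1) * (B + itime e + 10)" using w by simp
  ultimately show ?thesis using w by blast
qed

text \<open>The offset \<open>c\<close> is the first index copied: 0 for ranking cells, 1 for
  vectors indexed from 1.\<close>

definition copy_loop :: "string \<Rightarrow> string \<Rightarrow> int \<Rightarrow> iexp \<Rightarrow> com" where
  "copy_loop dst src c e = for_loop e
    (IAssign dst (IAdd (var ''t'') (IConst c)) (ICell src (IAdd (var ''t'') (IConst c))))"

lemma exec_copy_loop:
  assumes names: "dst \<noteq> src" "dst \<noteq> ''t''" "src \<noteq> ''t''"
    and bound: "\<And>f h. ival e ((fst s)(''t'' := f, dst := h), snd s) = int m"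
  shows "\<exists>\<tau>. exec (copy_loop dst src c e) s \<tau>
      ((fst s)(''t'' := (fst s ''t'')(0 := int m),
        dst := (\<lambda>z. if c \<le> z \<and> z < c + int m then fst s src z else fst s dst z)), snd s) \<and>
    \<tau> \<le> (m + 1) * (itime e + 20)"
proof -
  \<comment> \<open>\<open>st j\<close> is the exact state after \<open>j\<close> rounds, so
    equality with it serves as the invariant.\<close>
  define st where "st j = ((fst s)(''t'' := (fst s ''t'')(0 := int j),
    dst := (\<lambda>z. if c \<le> z \<and> z < c + int j then fst s src z else fst s dst z)), snd s)" for j
  let ?body = "IAssign dst (IAdd (var ''t'') (IConst c)) (ICell src (IAdd (var ''t'') (IConst c)))"
  have "\<exists>\<tau> s'. exec (for_loop e ?body) s \<tau> s' \<and> \<tau> \<le> (m + 1) * (10 + itime e + 10) \<and> s' = st m"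
  proof (rule exec_for_loop)
    show "set_counter 0 s = st 0"
      using names by (auto simp: set_counter_def st_def fun_eq_iff)
  next
    fix j s1 assume "j < m" and s1: "s1 = st j"
    show "\<exists>\<tau> s'. exec ?body s1 \<tau> s' \<and> \<tau> \<le> 10 \<and> set_counter (fst s' ''t'' 0 + 1) s' = st (Suc j)"
    proof (intro exI conjI)
      show "exec ?body s1 10
        ((fst s1)(dst := (fst s1 dst)(int j + c := fst s src (int j + c))), snd s1)"
        using exec.IAssign[of dst "IAdd (var ''t'') (IConst c)"
          "ICell src (IAdd (var ''t'') (IConst c))" s1] names by (simp add: s1 st_def eval_nat_numeral)
    qed (use names in \<open>auto simp: s1 st_def set_counter_def fun_eq_iff\<close>)
  next
    fix j s1 assume "s1 = st j"
    then show "ival e s1 = int m \<and> fst s1 ''t'' 0 = int j"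
      using names bound by (simp add: st_def)
  qed
  then show ?thesis unfolding copy_loop_def st_def by (simp add: add.commute)
qed

section \<open>Computing the majority tournament\<close>

text \<open>For the counter value \<open>(i * d + j) * d + l\<close> this is
  \<open>i * d + j\<close>, the cell of position \<open>j\<close> in ranking
  \<open>i\<close>.\<close>

definition first_cell :: iexp where
  "first_cell = IDiv (var ''t'') (var ''d'')"

text \<open>For the same counter value this is \<open>i * d + l\<close>; the subtraction expresses
  the remainder modulo \<open>d\<close> through division.\<close>

definition second_cell :: iexp where
  "second_cell = IAdd (IMul (IDiv (var ''t'') (IMul (var ''d'') (var ''d''))) (var ''d''))
    (ISub (var ''t'') (IMul (IDiv (var ''t'') (var ''d'')) (var ''d'')))"

text \<open>The address of the arc between the two candidates read; candidates count from 1, cells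
  from 0.\<close>

definition arc_cell :: iexp where
  "arc_cell = IAdd (IMul (ISub (ICell ''rankings'' first_cell) (IConst 1)) (var ''d''))
    (ISub (ICell ''rankings'' second_cell) (IConst 1))"

text \<open>Step \<open>(i * d + j) * d + l\<close> of the loop compares the positions \<open>j\<close> and \<open>l\<close> of the \<open>i\<close>-th ranking.\<close>

definition weight_loop :: com where
  "weight_loop = for_loop (IMul (var ''n'') (IMul (var ''d'') (var ''d'')))
    (Cond (ILess first_cell second_cell)
      (RAssign ''2w'' arc_cell
        (RAdd (RCell ''2w'' arc_cell) (RDiv (ROfInt (IConst 1)) (ROfInt (var ''n'')))))
      Skip)"

text \<open>The condition under which step \<open>t\<close> of the loop increments weight cell
  \<open>z\<close>, where \<open>R\<close> holds the rankings.\<close>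

definition hits :: "nat \<Rightarrow> (int \<Rightarrow> int) \<Rightarrow> nat \<Rightarrow> int \<Rightarrow> bool" where
  "hits d R t z \<longleftrightarrow> t div d < t div (d * d) * d + t mod d \<and>
    (R (int (t div d)) - 1) * int d + (R (int (t div (d * d) * d + t mod d)) - 1) = z"

lemma exec_weight_loop:
  assumes d: "fst s ''d'' 0 = int d" and n: "fst s ''n'' 0 = int n"
  shows "\<exists>\<tau>. exec weight_loop s \<tau> ((fst s)(''t'' := (fst s ''t'')(0 := int (n * (d * d)))),
      (snd s)(''2w'' := (\<lambda>z. snd s ''2w'' z +
        (\<Sum>t<n * (d * d). if hits d (fst s ''rankings'') t z then 1 / real n else 0)))) \<and>
    \<tau> \<le> (n * (d * d) + 1) * 200"
proof -
  \<comment> \<open>After \<open>j\<close> steps, cell \<open>z\<close> has gained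
    \<open>1 / n\<close> for each earlier step that hits it.\<close>
  define st where "st j = ((fst s)(''t'' := (fst s ''t'')(0 := int j)),
    (snd s)(''2w'' := (\<lambda>z. snd s ''2w'' z +
      (\<Sum>t<j. if hits d (fst s ''rankings'') t z then 1 / real n else 0))))" for j
  let ?m = "n * (d * d)"
  let ?e = "IMul (var ''n'') (IMul (var ''d'') (var ''d''))"
  let ?asg = "RAssign ''2w'' arc_cell
        (RAdd (RCell ''2w'' arc_cell) (RDiv (ROfInt (IConst 1)) (ROfInt (var ''n''))))"
  let ?body = "Cond (ILess first_cell second_cell) ?asg Skip"
  have "\<exists>\<tau> s'. exec (for_loop ?e ?body) s \<tau> s' \<and> \<tau> \<le> (?m + 1) * (150 + itime ?e + 10) \<and> s' = st ?m"
  proof (rule exec_for_loop)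
    show "set_counter 0 s = st 0"
      by (auto simp: set_counter_def st_def fun_eq_iff)
  next
    fix j s1 assume "j < ?m" and s1: "s1 = st j"
    let ?R = "fst s ''rankings''"
    let ?a = "(?R (int (j div d)) - 1) * int d + (?R (int (j div (d * d) * d + j mod d)) - 1)"
    have v1: "ival first_cell s1 = int (j div d)"
      using d by (simp add: first_cell_def s1 st_def zdiv_int)
    have v2: "ival second_cell s1 = int (j div (d * d) * d + j mod d)"
      using d by (simp add: second_cell_def s1 st_def zdiv_int zmod_int minus_div_mult_eq_mod)
    have R1: "fst s1 ''rankings'' = ?R" "fst s1 ''n'' 0 = int n" "fst s1 ''d'' 0 = int d"
      using d n by (simp_all add: s1 st_def)
    have va: "ival arc_cell s1 = ?a"
      by (simp add: arc_cell_def v1 v2 R1)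
    show "\<exists>\<tau> s'. exec ?body s1 \<tau> s' \<and> \<tau> \<le> 150 \<and> set_counter (fst s' ''t'' 0 + 1) s' = st (Suc j)"
    proof (cases "j div d < j div (d * d) * d + j mod d")
      case True
      let ?s' = "(fst s1, (snd s1)(''2w'' := (snd s1 ''2w'')(?a := snd s1 ''2w'' ?a + 1 / real n)))"
      have "exec ?asg s1 (1 + itime arc_cell + rtime (RAdd (RCell ''2w'' arc_cell)
          (RDiv (ROfInt (IConst 1)) (ROfInt (var ''n''))))) ?s'"
        using exec.RAssign[of "''2w''" arc_cell "RAdd (RCell ''2w'' arc_cell)
          (RDiv (ROfInt (IConst 1)) (ROfInt (var ''n'')))" s1] by (simp add: va R1)
      then have "exec ?body s1 (1 + btime (ILess first_cell second_cell) + (1 + itime arc_cell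
          + rtime (RAdd (RCell ''2w'' arc_cell)
          (RDiv (ROfInt (IConst 1)) (ROfInt (var ''n'')))))) ?s'"
        using True by (intro exec.CondT) (simp_all only: bval.simps v1 v2 of_nat_less_iff)
      moreover have "set_counter (fst ?s' ''t'' 0 + 1) ?s' = st (Suc j)"
        using True by (auto simp: set_counter_def s1 st_def fun_eq_iff hits_def)
      moreover have "1 + btime (ILess first_cell second_cell) + (1 + itime arc_cell
          + rtime (RAdd (RCell ''2w'' arc_cell)
          (RDiv (ROfInt (IConst 1)) (ROfInt (var ''n''))))) \<le> 150"
        by (simp add: arc_cell_def first_cell_def second_cell_def)
      ultimately show ?thesis by blast
    next
      case False
      have "exec ?body s1 (1 + btime (ILess first_cell second_cell) + 1) s1"
        using False by (intro exec.CondF exec.Skip) (simp only: bval.simps v1 v2 of_nat_less_iff not_False_eq_True)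
      moreover have "set_counter (fst s1 ''t'' 0 + 1) s1 = st (Suc j)"
        using False by (auto simp: set_counter_def s1 st_def fun_eq_iff hits_def)
      moreover have "1 + btime (ILess first_cell second_cell) + 1 \<le> 150"
        by (simp add: first_cell_def second_cell_def)
      ultimately show ?thesis by blast
    qed
  next
    fix j s1 assume "s1 = st j"
    then show "ival ?e s1 = int ?m \<and> fst s1 ''t'' 0 = int j"
      using d n by (simp add: st_def)
  qed
  then obtain \<tau> where "exec weight_loop s \<tau> (st ?m)" "\<tau> \<le> (?m + 1) * (150 + itime ?e + 10)"
    unfolding weight_loop_def by blast
  moreover from this(2) have "\<tau> \<le> (?m + 1) * 200" by simp
  ultimately show ?thesis unfolding st_def by blast
qed

lemma card_index_eq:
  "distinct xs \<Longrightarrow> card {i. i < length xs \<and> P (xs ! i)} = card {x \<in> set xs. P x}"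
proof -
  assume d: "distinct xs"
  have "{x \<in> set xs. P x} = (!) xs ` {i. i < length xs \<and> P (xs ! i)}"
    by (auto simp: in_set_conv_nth)
  moreover have "inj_on ((!) xs) {i. i < length xs \<and> P (xs ! i)}"
    using d by (auto simp: inj_on_def nth_eq_iff_index_eq)
  ultimately show ?thesis by (simp add: card_image)
qed

text \<open>The address of an arc determines its two candidates, and each ranking has at most one
  pair of positions holding them in order, so the hits count the rankings that follow the arc.
  Diagonal cells are never hit because distinct positions hold distinct candidates.\<close>

lemma sum_hits_eq_weight_cells:
  assumes d: "1 \<le> d" and xs: "set xs \<subseteq> rankings d" "distinct xs"
  shows "(\<Sum>t<length xs * (d * d). if hits d (ranking_cells d xs) t z then 1 / real (length xs) else 0)
    = weight_cells d (majority_weight (set xs)) z"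
proof -
  let ?n = "length xs"
  define H where "H = {t. t < ?n * (d * d) \<and> hits d (ranking_cells d xs) t z}"
  \<comment> \<open>Mixed-radix numbering of the steps; division and remainder by \<open>d\<close>
    recover the ranking and the two positions.\<close>
  define pos where "pos = (\<lambda>(i, j, l). (i * d + j) * d + l)"
  define valid where "valid \<longleftrightarrow> 0 \<le> z \<and> z < int (d * d) \<and> nat z div d \<noteq> nat z mod d"
  define a where "a = nat z div d + 1"
  define b where "b = nat z mod d + 1"
  have r: "length (xs ! i) = d" "distinct (xs ! i)" "set (xs ! i) = {1..d}" if "i < ?n" for i
    using rankingsD[of "xs ! i" d] subsetD[OF xs(1) nth_mem[OF that]] by auto
  have cell: "ranking_cells d xs (int (i * d + j)) = int (xs ! i ! j)" if "i < ?n" "j < d" for i j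
  proof -
    have "i * d + j < Suc i * d" using that by simp
    also have "\<dots> \<le> ?n * d" using that by (intro mult_right_mono) auto
    finally show ?thesis using that by (simp add: ranking_cells_def flip: of_nat_mult of_nat_add)
  qed
  have hits_pos: "hits d (ranking_cells d xs) (pos (i, j, l)) z \<longleftrightarrow>
      valid \<and> j < l \<and> xs ! i ! j = a \<and> xs ! i ! l = b" if i: "i < ?n" and jl: "j < d" "l < d" for i j l
  proof -
    have p1: "pos (i, j, l) div d = i * d + j" "pos (i, j, l) mod d = l"
      using jl by (simp_all add: pos_def)
    then have p2: "pos (i, j, l) div (d * d) = i" using jl by (simp add: div_mult2_eq)
    \<comment> \<open>Shifting the candidates to \<open>0, ..., d - 1\<close> makes
      \<open>u * d + v\<close> decode uniquely.\<close>
    obtain u where u: "xs ! i ! j = Suc u" "u < d"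
      using r[OF i] nth_mem[of j "xs ! i"] jl by (cases "xs ! i ! j") auto
    obtain v where v: "xs ! i ! l = Suc v" "v < d"
      using r[OF i] nth_mem[of l "xs ! i"] jl by (cases "xs ! i ! l") auto
    have neq: "u \<noteq> v" if "j < l"
      using that r[OF i] jl u v nth_eq_iff_index_eq[of "xs ! i" j l] by auto
    have "hits d (ranking_cells d xs) (pos (i, j, l)) z \<longleftrightarrow> j < l \<and> int (u * d + v) = z"
      unfolding hits_def p1 p2 cell[OF i jl(1)] cell[OF i jl(2)] by (simp add: u v)
    also have "\<dots> \<longleftrightarrow> valid \<and> j < l \<and> xs ! i ! j = a \<and> xs ! i ! l = b"
    proof
      assume *: "j < l \<and> int (u * d + v) = z"
      have "u * d + v < Suc u * d" using v by simp
      also have "\<dots> \<le> d * d" using u by (intro mult_right_mono) auto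
      finally have "z < int (d * d)" using * by (metis of_nat_less_iff)
      moreover have "nat z = u * d + v" using * by (metis nat_int)
      ultimately show "valid \<and> j < l \<and> xs ! i ! j = a \<and> xs ! i ! l = b"
        using * u v neq by (auto simp: valid_def a_def b_def)
    next
      assume *: "valid \<and> j < l \<and> xs ! i ! j = a \<and> xs ! i ! l = b"
      then have "u = nat z div d" "v = nat z mod d" using u v by (auto simp: a_def b_def)
      then have "u * d + v = nat z" by simp
      then show "j < l \<and> int (u * d + v) = z" using * by (simp add: valid_def)
    qed
    finally show ?thesis .
  qed
  have pos_surj: "\<exists>i j l. i < ?n \<and> j < d \<and> l < d \<and> t = pos (i, j, l)" if "t < ?n * (d * d)" for t
  proof (intro exI conjI)
    show "t div d div d < ?n" using that by (simp add: less_mult_imp_div_less mult.assoc)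
    show "t = pos (t div d div d, t div d mod d, t mod d)" by (simp add: pos_def)
  qed (use d in auto)
  have pos_less: "pos (i, j, l) < ?n * (d * d)" if "i < ?n" "j < d" "l < d" for i j l
  proof -
    have "i * d + j < Suc i * d" using that by simp
    also have "\<dots> \<le> ?n * d" using that by (intro mult_right_mono) auto
    finally have "Suc (i * d + j) * d \<le> (?n * d) * d" by (intro mult_right_mono) auto
    then show ?thesis using that by (simp add: pos_def)
  qed
  have sum: "(\<Sum>t<?n * (d * d). if hits d (ranking_cells d xs) t z then 1 / real ?n else 0)
      = real (card H) / real ?n"
    by (subst sum.inter_filter[symmetric]) (auto simp: H_def)
  show ?thesis
  proof (cases valid)
    case False
    have "H = {}"
    proof (rule equals0I)
      fix t assume t: "t \<in> H"
      then obtain i j l where "i < ?n" "j < d" "l < d" "t = pos (i, j, l)"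
        using pos_surj[of t] by (auto simp: H_def)
      then show False using t hits_pos[of i j l] False by (simp add: H_def)
    qed
    then show ?thesis using sum False by (auto simp: weight_cells_def valid_def)
  next
    case True
    let ?Q = "{(i, j, l). i < ?n \<and> j < l \<and> l < d \<and> xs ! i ! j = a \<and> xs ! i ! l = b}"
    have "H = pos ` ?Q"
    proof (rule set_eqI)
      fix t
      show "t \<in> H \<longleftrightarrow> t \<in> pos ` ?Q"
      proof
        assume t: "t \<in> H"
        then obtain i j l where ijl: "i < ?n" "j < d" "l < d" "t = pos (i, j, l)"
          using pos_surj[of t] by (auto simp: H_def)
        then have "(i, j, l) \<in> ?Q" using t hits_pos[of i j l] by (simp add: H_def)
        then show "t \<in> pos ` ?Q" using ijl by blast
      next
        assume "t \<in> pos ` ?Q"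
        then obtain i j l where ijl: "i < ?n" "j < l" "l < d" "xs ! i ! j = a" "xs ! i ! l = b"
          and t: "t = pos (i, j, l)" by auto
        then show "t \<in> H" using True hits_pos[of i j l] pos_less[of i j l] by (simp add: H_def)
      qed
    qed
    moreover have "inj_on pos ?Q"
    proof (rule inj_onI)
      fix x y assume x: "x \<in> ?Q" and y: "y \<in> ?Q" and eq: "pos x = pos y"
      obtain i j l i' j' l' where xy: "x = (i, j, l)" "y = (i', j', l')" by (metis prod_cases3)
      have "pos x mod d = pos y mod d" "pos x div d mod d = pos y div d mod d"
        "pos x div d div d = pos y div d div d" using eq by auto
      then show "x = y" using x y xy by (simp add: pos_def)
    qed
    ultimately have "card H = card ?Q" by (simp add: card_image)
    \<comment> \<open>A ranking lists each candidate once, so its index determines both positions,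
      and triples can be counted as rankings.\<close>
    moreover have "inj_on fst ?Q"
    proof (rule inj_onI)
      fix x y assume x: "x \<in> ?Q" and y: "y \<in> ?Q" and eq: "fst x = fst y"
      obtain i j l j' l' where xy: "x = (i, j, l)" "y = (i, j', l')"
        using eq by (cases x; cases y) auto
      then have "i < ?n" "j < d" "j' < d" "l < d" "l' < d" "xs ! i ! j = xs ! i ! j'"
        "xs ! i ! l = xs ! i ! l'" using x y by auto
      then have "j = j'" "l = l'" using r[of i] by (simp_all add: nth_eq_iff_index_eq)
      then show "x = y" using xy by simp
    qed
    ultimately have "card H = card (fst ` ?Q)" by (simp only: card_image)
    also have "fst ` ?Q = {i. i < ?n \<and> precedes (xs ! i) a b}"
    proof (rule set_eqI)
      fix i
      have "i \<in> fst ` ?Q \<longleftrightarrow> i < ?n \<and> (\<exists>j l. j < l \<and> l < d \<and> xs ! i ! j = a \<and> xs ! i ! l = b)"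
        by (simp add: image_iff)
      then show "i \<in> fst ` ?Q \<longleftrightarrow> i \<in> {i. i < ?n \<and> precedes (xs ! i) a b}"
        using r(1)[of i] by (auto simp: precedes_def)
    qed
    also have "card \<dots> = card {\<pi> \<in> set xs. precedes \<pi> a b}"
      by (rule card_index_eq) fact
    finally show ?thesis
      using True sum xs(2) by (simp add: weight_cells_def valid_def majority_weight_def
        distinct_card a_def b_def)
  qed
qed

section \<open>The combined program\<close>

text \<open>
  The two given programs run on disjoint families of arrays. The arrays \<open>alpha\<close> and \<open>beta\<close> keep their
  names because their length \<open>g\<close> is not bounded in terms of \<open>n\<close> and \<open>d\<close> (groups may be empty), so
  there is no time to copy them.
\<close>

definition name1 :: "string \<Rightarrow> string" where
  "name1 x = CHR ''1'' # x"

definition name2 :: "string \<Rightarrow> string" where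
  "name2 x = (if x = ''alpha'' \<or> x = ''beta'' then x else CHR ''2'' # x)"

lemma inj_name1: "inj name1"
  by (simp add: inj_def name1_def)

lemma inj_name2: "inj name2"
  by (auto simp: inj_def name2_def)

text \<open>The first characters differ: \<open>1\<close> on one side; \<open>2\<close>,
  \<open>a\<close> or \<open>b\<close> on the other.\<close>

lemma name1_neq_name2: "name1 x \<noteq> name2 y"
  by (auto simp: name1_def name2_def)

definition copy_var :: "string \<Rightarrow> string \<Rightarrow> com" where
  "copy_var dst src = IAssign dst (IConst 0) (var src)"

lemma exec_copy_var:
  "exec (copy_var dst src) s 4 ((fst s)(dst := (fst s dst)(0 := fst s src 0)), snd s)"
  using exec.IAssign[of dst "IConst 0" "var src" s]
  by (simp add: copy_var_def eval_nat_numeral)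

definition copy_vars :: com where
  "copy_vars = Seq (copy_var ''1d'' ''d'') (Seq (copy_var ''1n'' ''n'') (Seq (copy_var ''2d'' ''d'')
    (Seq (copy_var ''2k'' ''k'') (copy_var ''2g'' ''g''))))"

definition prepare :: com where
  "prepare = Seq copy_vars
    (Seq (copy_loop ''1rankings'' ''rankings'' 0 (IMul (var ''n'') (var ''d'')))
      (Seq (copy_loop ''2col'' ''group'' 1 (var ''d'')) weight_loop))"

lemma exec_copy_vars:
  "exec copy_vars s 20 ((fst s)(''1d'' := (fst s ''1d'')(0 := fst s ''d'' 0),
    ''1n'' := (fst s ''1n'')(0 := fst s ''n'' 0), ''2d'' := (fst s ''2d'')(0 := fst s ''d'' 0),
    ''2k'' := (fst s ''2k'')(0 := fst s ''k'' 0), ''2g'' := (fst s ''2g'')(0 := fst s ''g'' 0)), snd s)"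
  using exec.Seq[OF exec_copy_var[of "''1d''" "''d''" s]
    exec.Seq[OF exec_copy_var[of "''1n''" "''n''"] exec.Seq[OF exec_copy_var[of "''2d''" "''d''"]
      exec.Seq[OF exec_copy_var[of "''2k''" "''k''"] exec_copy_var[of "''2g''" "''g''"]]]]]
  by (simp add: copy_vars_def)

text \<open>Each program must find exactly its prescribed input, with zeros elsewhere. This survives
  the preparation because the scratch array \<open>''t''\<close> lies in neither family of renamed
  arrays.\<close>

lemma exec_prepare:
  fixes d g k :: nat and xs :: "nat list list"
  assumes d: "1 \<le> d" and n: "1 \<le> length xs" and xs: "set xs \<subseteq> rankings d" "distinct xs"
  shows "\<exists>\<tau> s. exec prepare (fair_rank_aggregation_input d xs g G \<alpha> \<beta> k) \<tau> s \<and>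
    \<tau> \<le> 1000 * (length xs * d\<^sup>2) \<and>
    pull name1 s = rank_aggregation_input d xs \<and>
    pull name2 s = bipartition_input d (majority_weight (set xs)) g
      (\<lambda>v. THE i. i \<in> {1..g} \<and> v \<in> G i) \<alpha> \<beta> k \<and>
    fst s ''d'' 0 = int d"
proof -
  let ?n = "length xs"
  let ?col = "\<lambda>v. THE i. i \<in> {1..g} \<and> v \<in> G i"
  \<comment> \<open>\<open>s1\<close> to \<open>s4\<close> are the exact states after the four
    stages of \<open>prepare\<close>.\<close>
  define s0 where "s0 = fair_rank_aggregation_input d xs g G \<alpha> \<beta> k"
  define s1 where "s1 = ((fst s0)(''1d'' := scalar d, ''1n'' := scalar ?n, ''2d'' := scalar d,
    ''2k'' := scalar k, ''2g'' := scalar g), snd s0)"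
  define s2 where "s2 = ((fst s1)(''t'' := scalar (?n * d), ''1rankings'' := ranking_cells d xs), snd s1)"
  define s3 where "s3 = ((fst s2)(''t'' := scalar d, ''2col'' := vector d (\<lambda>v. int (?col v))), snd s2)"
  define s4 where "s4 = ((fst s3)(''t'' := scalar (?n * (d * d))),
    (snd s3)(''2w'' := weight_cells d (majority_weight (set xs))))"
  have s0: "fst s0 ''d'' = scalar d" "fst s0 ''n'' = scalar ?n" "fst s0 ''k'' = scalar k"
    "fst s0 ''g'' = scalar g" "fst s0 ''rankings'' = ranking_cells d xs"
    "fst s0 ''group'' = vector d (\<lambda>v. int (?col v))"
    "fst s0 ''1d'' = (\<lambda>_. 0)" "fst s0 ''1n'' = (\<lambda>_. 0)" "fst s0 ''2d'' = (\<lambda>_. 0)"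
    "fst s0 ''2k'' = (\<lambda>_. 0)" "fst s0 ''2g'' = (\<lambda>_. 0)" "fst s0 ''1rankings'' = (\<lambda>_. 0)"
    "fst s0 ''2col'' = (\<lambda>_. 0)" "fst s0 ''t'' = (\<lambda>_. 0)" "snd s0 ''2w'' = (\<lambda>_. 0)"
    by (simp_all add: s0_def fair_rank_aggregation_input_def)
  have sc: "(\<lambda>_. 0)(0 := int m) = scalar m" "(scalar m')(0 := int m) = scalar m" "scalar m 0 = int m"
    for m m' by (auto simp: scalar_def)
  have e1: "exec copy_vars s0 20 s1"
    using exec_copy_vars[of s0] unfolding s0 sc s1_def .
  obtain \<tau>2 where e2: "exec (copy_loop ''1rankings'' ''rankings'' 0 (IMul (var ''n'') (var ''d''))) s1 \<tau>2 s2"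
    and t2: "\<tau>2 \<le> (?n * d + 1) * 25"
  proof -
    have f: "fst s1 ''t'' = (\<lambda>_. 0)" "fst s1 ''rankings'' = ranking_cells d xs"
      "fst s1 ''1rankings'' = (\<lambda>_. 0)" by (simp_all add: s1_def s0)
    have cells: "(\<lambda>z. if 0 \<le> z \<and> z < 0 + int (?n * d) then ranking_cells d xs z else 0)
        = ranking_cells d xs"
      by (auto simp: ranking_cells_def fun_eq_iff)
    show ?thesis
      using exec_copy_loop[of "''1rankings''" "''rankings''" "IMul (var ''n'') (var ''d'')" s1 "?n * d" 0]
        that unfolding f cells sc s2_def[symmetric] by (auto simp: s1_def s0 sc)
  qed
  obtain \<tau>3 where e3: "exec (copy_loop ''2col'' ''group'' 1 (var ''d'')) s2 \<tau>3 s3"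
    and t3: "\<tau>3 \<le> (d + 1) * 22"
  proof -
    have f: "fst s2 ''t'' = scalar (?n * d)" "fst s2 ''group'' = vector d (\<lambda>v. int (?col v))"
      "fst s2 ''2col'' = (\<lambda>_. 0)" by (simp_all add: s2_def s1_def s0)
    have cells: "(\<lambda>z. if 1 \<le> z \<and> z < 1 + int d then vector d (\<lambda>v. int (?col v)) z else 0)
        = vector d (\<lambda>v. int (?col v))"
      by (auto simp: vector_def fun_eq_iff)
    show ?thesis
      using exec_copy_loop[of "''2col''" "''group''" "var ''d''" s2 d 1]
        that unfolding f cells sc s3_def[symmetric] by (auto simp: s2_def s1_def s0 sc)
  qed
  obtain \<tau>4 where e4: "exec weight_loop s3 \<tau>4 s4" and t4: "\<tau>4 \<le> (?n * (d * d) + 1) * 200"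
  proof -
    have f: "fst s3 ''t'' = scalar d" "fst s3 ''d'' 0 = int d" "fst s3 ''n'' 0 = int ?n"
      "fst s3 ''rankings'' = ranking_cells d xs" "snd s3 ''2w'' = (\<lambda>_. 0)"
      by (simp_all add: s3_def s2_def s1_def s0 sc)
    show ?thesis
      using exec_weight_loop[OF f(2,3)] that
      unfolding f sc sum_hits_eq_weight_cells[OF d xs] add_0 s4_def[symmetric] by blast
  qed
  have "exec prepare s0 (20 + (\<tau>2 + (\<tau>3 + \<tau>4))) s4"
    unfolding prepare_def by (rule exec.Seq[OF e1 exec.Seq[OF e2 exec.Seq[OF e3 e4]]])
  moreover have "20 + (\<tau>2 + (\<tau>3 + \<tau>4)) \<le> 1000 * (?n * d\<^sup>2)"
  proof -
    let ?N = "?n * (d * d)"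
    have "?n * d * 1 \<le> ?n * d * d" "1 * d \<le> ?n * d"
      using d n by (intro mult_mono; simp)+
    then have "?n * d \<le> ?N" "d \<le> ?N" by (simp_all only: mult.assoc mult_1_left mult_1_right)
    moreover have "1 \<le> ?N" using \<open>d \<le> ?N\<close> d by linarith
    \<comment> \<open>All loop lengths are at most \<open>N\<close>, and \<open>1 \<le> N\<close>
      absorbs the additive constants.\<close>
    moreover have "20 + (a + (b + c)) \<le> 1000 * N"
      if "a \<le> (e + 1) * 25" "b \<le> (d + 1) * 22" "c \<le> (N + 1) * 200" "e \<le> N" "d \<le> N" "1 \<le> N"
      for a b c d e N :: nat
      using that by simp
    ultimately show ?thesis using t2 t3 t4 unfolding power2_eq_square by blast
  qed
  moreover have "pull name1 s4 = rank_aggregation_input d xs"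
    by (auto simp: pull_def name1_def s4_def s3_def s2_def s1_def s0_def
      fair_rank_aggregation_input_def rank_aggregation_input_def fun_eq_iff)
  moreover have "pull name2 s4 = bipartition_input d (majority_weight (set xs)) g ?col \<alpha> \<beta> k"
    by (auto simp: pull_def name2_def s4_def s3_def s2_def s1_def s0_def
      fair_rank_aggregation_input_def bipartition_input_def fun_eq_iff)
  moreover have "fst s4 ''d'' 0 = int d"
    by (simp add: s4_def s3_def s2_def s1_def s0 sc)
  ultimately show ?thesis unfolding s0_def by blast
qed

section \<open>Writing out the promoted ranking\<close>

definition emit_loop :: "bexp \<Rightarrow> com" where
  "emit_loop b = for_loop (var ''d'') (Cond b
    (Seq (IAssign ''out'' (var ''p'') (ICell ''1out'' (var ''t'')))
      (IAssign ''p'' (IConst 0) (IAdd (var ''p'') (IConst 1)))) Skip)"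

definition emitted :: "int list \<Rightarrow> state \<Rightarrow> bool" where
  "emitted ys s \<longleftrightarrow> fst s ''p'' 0 = int (length ys) \<and> (\<forall>i<length ys. fst s ''out'' (int i) = ys ! i)"

lemma ranking_output_emitted:
  "emitted ys s \<Longrightarrow> length ys = d \<Longrightarrow> ranking_output d s = map nat ys"
  by (intro nth_equalityI) (simp_all add: ranking_output_def emitted_def)

lemma emitted_snoc:
  assumes "emitted zs s"
  shows "emitted (zs @ [x]) (set_counter c ((fst s)(''out'' := (fst s ''out'')(int (length zs) := x),
    ''p'' := (fst s ''p'')(0 := int (length zs) + 1)), snd s))"
  using assms by (simp add: emitted_def set_counter_def nth_append)

text \<open>The output may already hold a prefix \<open>ys\<close>, with \<open>''p''\<close>
  pointing behind it, so that two such loops can be chained. The test \<open>b\<close> has to be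
  determined by the counter and by arrays that the loop does not write.\<close>

lemma exec_emit_loop:
  assumes d: "fst s ''d'' 0 = int d" and ys: "emitted ys s"
    and b: "\<And>j s'. agree_off {''t'', ''p'', ''out''} s s' \<Longrightarrow> fst s' ''t'' 0 = int j \<Longrightarrow>
      bval b s' \<longleftrightarrow> P (fst s ''1out'' (int j))"
  shows "\<exists>\<tau> s'. exec (emit_loop b) s \<tau> s' \<and> \<tau> \<le> (d + 1) * (btime b + 40) \<and>
    agree_off {''t'', ''p'', ''out''} s s' \<and>
    emitted (ys @ filter P (map (\<lambda>j. fst s ''1out'' (int j)) [0..<d])) s'"
proof -
  let ?zs = "\<lambda>j. ys @ filter P (map (\<lambda>j. fst s ''1out'' (int j)) [0..<j])"
  define I where "I j s' \<longleftrightarrow> agree_off {''t'', ''p'', ''out''} s s' \<and> fst s' ''t'' 0 = int j \<and>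
    emitted (?zs j) s'" for j s'
  let ?out = "IAssign ''out'' (var ''p'') (ICell ''1out'' (var ''t''))"
  let ?inc = "IAssign ''p'' (IConst 0) (IAdd (var ''p'') (IConst 1))"
  let ?body = "Cond b (Seq ?out ?inc) Skip"
  have "\<exists>\<tau> s'. exec (for_loop (var ''d'') ?body) s \<tau> s' \<and>
      \<tau> \<le> (d + 1) * ((btime b + 20) + itime (var ''d'') + 10) \<and> I d s'"
  proof (rule exec_for_loop)
    show "I 0 (set_counter 0 s)"
      using ys by (auto simp: I_def set_counter_def agree_off_def emitted_def)
  next
    fix j s1 assume "j < d" and I: "I j s1"
    then have bv: "bval b s1 \<longleftrightarrow> P (fst s ''1out'' (int j))" using b by (simp add: I_def)
    have v: "fst s1 ''1out'' = fst s ''1out''" "fst s1 ''t'' 0 = int j"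
      "fst s1 ''p'' 0 = int (length (?zs j))"
      using I by (auto simp: I_def agree_off_def emitted_def)
    show "\<exists>\<tau> s'. exec ?body s1 \<tau> s' \<and> \<tau> \<le> btime b + 20 \<and>
        I (Suc j) (set_counter (fst s' ''t'' 0 + 1) s')"
    proof (cases "P (fst s ''1out'' (int j))")
      case True
      let ?s2 = "((fst s1)(''out'' := (fst s1 ''out'')
        (int (length (?zs j)) := fst s ''1out'' (int j))), snd s1)"
      let ?s3 = "((fst s1)(''out'' := (fst s1 ''out'')
        (int (length (?zs j)) := fst s ''1out'' (int j)),
        ''p'' := (fst s1 ''p'')(0 := int (length (?zs j)) + 1)), snd s1)"
      have "exec ?out s1 (1 + itime (var ''p'') + itime (ICell ''1out'' (var ''t''))) ?s2"
        using exec.IAssign[of "''out''" "var ''p''" "ICell ''1out'' (var ''t'')" s1]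
        by (simp only: ival.simps v)
      moreover have "exec ?inc ?s2 (1 + itime (IConst 0) + itime (IAdd (var ''p'') (IConst 1))) ?s3"
        using exec.IAssign[of "''p''" "IConst 0" "IAdd (var ''p'') (IConst 1)" ?s2] v by simp
      ultimately have "exec ?body s1 (1 + btime b +
        ((1 + itime (var ''p'') + itime (ICell ''1out'' (var ''t'')))
        + (1 + itime (IConst 0) + itime (IAdd (var ''p'') (IConst 1))))) ?s3"
        using True bv by (intro exec.CondT exec.Seq) simp_all
      moreover have "1 + btime b +
        ((1 + itime (var ''p'') + itime (ICell ''1out'' (var ''t'')))
        + (1 + itime (IConst 0) + itime (IAdd (var ''p'') (IConst 1)))) \<le> btime b + 20"
        by simp
      moreover have "I (Suc j) (set_counter (fst ?s3 ''t'' 0 + 1) ?s3)"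
      proof -
        have "agree_off {''t'', ''p'', ''out''} s (set_counter (fst ?s3 ''t'' 0 + 1) ?s3)"
          using I by (simp add: I_def set_counter_def agree_off_def)
        moreover have "fst (set_counter (fst ?s3 ''t'' 0 + 1) ?s3) ''t'' 0 = int (Suc j)"
          using v by (simp add: set_counter_def)
        moreover
        have zs: "?zs (Suc j) = ?zs j @ [fst s ''1out'' (int j)]" using True by simp
        have "emitted (?zs (Suc j)) (set_counter (fst ?s3 ''t'' 0 + 1) ?s3)"
          unfolding zs by (rule emitted_snoc) (use I in \<open>simp only: I_def\<close>)
        ultimately show ?thesis unfolding I_def by blast
      qed
      ultimately show ?thesis by blast
    next
      case False
      have "exec ?body s1 (1 + btime b + 1) s1"
        using False bv by (intro exec.CondF exec.Skip) simp
      moreover have "I (Suc j) (set_counter (fst s1 ''t'' 0 + 1) s1)"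
        using I False by (auto simp: I_def set_counter_def agree_off_def emitted_def)
      moreover have "1 + btime b + 1 \<le> btime b + 20" by simp
      ultimately show ?thesis by blast
    qed
  next
    fix j s1 assume "I j s1"
    then show "ival (var ''d'') s1 = int d \<and> fst s1 ''t'' 0 = int j"
      using d by (auto simp: I_def agree_off_def)
  qed
  then obtain \<tau> s' where e: "exec (emit_loop b) s \<tau> s'"
    and t: "\<tau> \<le> (d + 1) * ((btime b + 20) + itime (var ''d'') + 10)" and "I d s'"
    unfolding emit_loop_def by blast
  moreover have "(d + 1) * ((btime b + 20) + itime (var ''d'') + 10) \<le> (d + 1) * (btime b + 40)"
    by (intro mult_left_mono) auto
  ultimately show ?thesis unfolding I_def using le_trans by blast
qed

text \<open>Equality with 1, the membership mark of \<open>set_output\<close>, written as two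
  negated strict comparisons.\<close>

definition in_top :: bexp where
  "in_top = (let e = ICell ''2out'' (ICell ''1out'' (var ''t'')) in
    BAnd (BNot (ILess e (IConst 1))) (BNot (ILess (IConst 1) e)))"

definition merge :: com where
  "merge = Seq (IAssign ''p'' (IConst 0) (IConst 0)) (Seq (emit_loop in_top) (emit_loop (BNot in_top)))"

lemma bval_in_top:
  assumes "agree_off {''t'', ''p'', ''out''} s s'" and "fst s' ''t'' 0 = int j"
  shows "bval in_top s' \<longleftrightarrow> fst s ''2out'' (fst s ''1out'' (int j)) = 1"
proof -
  have "fst s' ''1out'' = fst s ''1out''" "fst s' ''2out'' = fst s ''2out''"
    using assms(1) by (simp_all add: agree_off_def)
  then show ?thesis using assms(2) by (auto simp: in_top_def Let_def)
qed

lemma exec_merge: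
  assumes d: "fst s ''d'' 0 = int d"
    and \<sigma>: "ranking_output d (pull name1 s) \<in> rankings d"
  shows "\<exists>\<tau> s'. exec merge s \<tau> s' \<and> \<tau> \<le> 150 * (d + 1) \<and>
    ranking_output d s' = promote (set_output d (pull name2 s)) (ranking_output d (pull name1 s))"
proof -
  let ?\<sigma> = "ranking_output d (pull name1 s)" and ?L = "set_output d (pull name2 s)"
  let ?vs = "map (\<lambda>j. fst s ''1out'' (int j)) [0..<d]"
  let ?P = "\<lambda>v. fst s ''2out'' v = 1"
  define s1 where "s1 = ((fst s)(''p'' := (fst s ''p'')(0 := 0)), snd s)"
  have e1: "exec (IAssign ''p'' (IConst 0) (IConst 0)) s 3 s1"
    using exec.IAssign[of "''p''" "IConst 0" "IConst 0" s] by (simp add: s1_def eval_nat_numeral)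
  have s1: "fst s1 ''d'' 0 = int d" "emitted [] s1" "fst s1 ''1out'' = fst s ''1out''"
    "fst s1 ''2out'' = fst s ''2out''"
    using d by (auto simp: s1_def emitted_def)
  obtain \<tau>2 s2 where e2: "exec (emit_loop in_top) s1 \<tau>2 s2"
    and t2: "\<tau>2 \<le> (d + 1) * (btime in_top + 40)"
    and a2: "agree_off {''t'', ''p'', ''out''} s1 s2" and m2: "emitted (filter ?P ?vs) s2"
    using exec_emit_loop[OF s1(1,2), of in_top ?P] bval_in_top[of s1] s1 by auto
  have s2: "fst s2 ''d'' 0 = int d" "fst s2 ''1out'' = fst s ''1out''"
    "fst s2 ''2out'' = fst s ''2out''"
    using a2 s1 by (auto simp: agree_off_def)
  obtain \<tau>3 s3 where e3: "exec (emit_loop (BNot in_top)) s2 \<tau>3 s3"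
    and t3: "\<tau>3 \<le> (d + 1) * (btime (BNot in_top) + 40)"
    and m3: "emitted (filter ?P ?vs @ filter (\<lambda>v. \<not> ?P v) ?vs) s3"
    using exec_emit_loop[OF s2(1) m2, of "BNot in_top" "\<lambda>v. \<not> ?P v"] bval_in_top[of s2] s2 by auto
  have "exec merge s (3 + (\<tau>2 + \<tau>3)) s3"
    unfolding merge_def by (rule exec.Seq[OF e1 exec.Seq[OF e2 e3]])
  moreover have "3 + (\<tau>2 + \<tau>3) \<le> 150 * (d + 1)"
    using t2 t3 by (simp add: in_top_def Let_def)
  moreover have "ranking_output d s3 = promote ?L ?\<sigma>"
  proof -
    let ?ws = "filter ?P ?vs @ filter (\<lambda>v. \<not> ?P v) ?vs"
    have \<sigma>_eq: "?\<sigma> = map nat ?vs"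
      by (simp add: ranking_output_def pull_def name1_def)
    have len: "length ?ws = d"
      using sum_length_filter_compl[of ?P ?vs] by simp
    have "ranking_output d s3 = map nat ?ws"
      using m3 len by (rule ranking_output_emitted)
    also have "\<dots> = promote ?L (map nat ?vs)"
    proof -
      \<comment> \<open>Decoding with \<open>nat\<close> loses nothing here: the decoded list is a
        ranking, so every \<open>nat v\<close> is at least 1 and hence \<open>v\<close> is
        positive.\<close>
      have "?P v \<longleftrightarrow> nat v \<in> ?L" if "v \<in> set ?vs" for v
      proof -
        have "nat v \<in> set (map nat ?vs)" using that unfolding set_map by (rule imageI)
        then have "nat v \<in> {1..d}" using rankingsD(2)[OF \<sigma>] unfolding \<sigma>_eq by blast
        moreover from this have "int (nat v) = v" by (cases "0 \<le> v") auto
        ultimately show ?thesis by (simp add: set_output_def pull_def name2_def)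
      qed
      then have "filter ?P ?vs = filter (\<lambda>v. nat v \<in> ?L) ?vs"
        "filter (\<lambda>v. \<not> ?P v) ?vs = filter (\<lambda>v. nat v \<notin> ?L) ?vs"
        by (blast intro: filter_cong)+
      then show ?thesis by (simp only: promote_def filter_map comp_def map_append)
    qed
    finally show ?thesis unfolding \<sigma>_eq .
  qed
  ultimately show ?thesis by blast
qed

section \<open>The approximation guarantee and running time of the combined program\<close>

theorem theorem3:
  fixes c1 c2 :: real
    and t1 :: "nat \<Rightarrow> nat \<Rightarrow> nat"
    and t2 :: "nat \<Rightarrow> nat"
    and A1 A2 :: com
  assumes "c1 \<ge> 1" and "rank_aggregation_algorithm c1 t1 A1"
    and "c2 \<ge> 1" and "colorful_bipartition_algorithm c2 t2 A2"
  shows "\<exists>A T. fair_rank_aggregation_algorithm (c1 + c2) T A \<and>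
    (\<lambda>(d, n). real (T d n))
      \<in> O[principal {(d, n). 1 \<le> d \<and> 1 \<le> n}](\<lambda>(d, n). real (n * d\<^sup>2 + t1 d n + t2 d))"
proof (intro exI conjI)
  let ?A = "Seq prepare (Seq (rename_com name1 A1) (Seq (rename_com name2 A2) merge))"
  \<comment> \<open>The preparation takes 1000 units of \<open>n * d\<^sup>2\<close>; the merge
    takes \<open>150 * (d + 1)\<close>, at most 300 such units.\<close>
  let ?T = "\<lambda>d n. 1300 * (n * d\<^sup>2 + t1 d n + t2 d)"
  show "(\<lambda>(d, n). real (?T d n))
      \<in> O[principal {(d, n). 1 \<le> d \<and> 1 \<le> n}](\<lambda>(d, n). real (n * d\<^sup>2 + t1 d n + t2 d))"
    by (rule landau_o.bigI[of 1300]) (auto simp: eventually_principal)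
  show "fair_rank_aggregation_algorithm (c1 + c2) ?T ?A"
    unfolding fair_rank_aggregation_algorithm_def
  proof (intro allI impI, elim conjE)
    fix d n :: nat and S xs g G \<alpha> \<beta> k
    assume d: "1 \<le> d" and n: "1 \<le> n" and S: "S \<subseteq> rankings d" "card S = n"
      and xs: "set xs = S" "distinct xs" and G: "group_partition d g G"
      and \<alpha>: "unit_vector_range g \<alpha>" and \<beta>: "unit_vector_range g \<beta>" and k: "k \<in> {1..d}"
    let ?F = "{\<sigma> \<in> rankings d. fair g G \<alpha> \<beta> k \<sigma>}"
    let ?col = "\<lambda>v. THE i. i \<in> {1..g} \<and> v \<in> G i"
    let ?F' = "{L. L \<subseteq> {1..d} \<and> card L = k \<and> colorful g ?col \<alpha> \<beta> L}"
    let ?w = "majority_weight S"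
    have len: "length xs = n" using xs S distinct_card[of xs] by simp
    have ne: "S \<noteq> {}" using S n by auto
    \<comment> \<open>Each candidate lies in exactly one group, so the description denotes that
      group.\<close>
    have col: "?col ` {1..d} \<subseteq> {1..g}"
    proof clarify
      fix v assume "v \<in> {1..d}"
      then obtain i where i: "i \<in> {1..g} \<and> v \<in> G i" using G unfolding group_partition_def by blast
      have "\<exists>!i. i \<in> {1..g} \<and> v \<in> G i"
        using i G unfolding group_partition_def disjoint_family_on_def by blast
      from theI'[OF this] show "?col v \<in> {1..g}" by blast
    qed
    obtain \<tau>0 s0 where e0: "exec prepare (fair_rank_aggregation_input d xs g G \<alpha> \<beta> k) \<tau>0 s0"
      and t0: "\<tau>0 \<le> 1000 * (n * d\<^sup>2)" and in1: "pull name1 s0 = rank_aggregation_input d xs"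
      and in2: "pull name2 s0 = bipartition_input d ?w g ?col \<alpha> \<beta> k" and d0: "fst s0 ''d'' 0 = int d"
      using exec_prepare[OF d, where xs = xs and g = g and G = G and \<alpha> = \<alpha> and \<beta> = \<beta> and k = k] n S xs len by auto
    obtain \<tau>1 o1 where "exec A1 (pull name1 s0) \<tau>1 o1" and time1: "\<tau>1 \<le> t1 d n"
      and \<sigma>: "approx_solution c1 (rankings d) (\<lambda>\<sigma>. real (Obj S \<sigma>)) (ranking_output d o1)"
      using assms(2) d n S xs unfolding rank_aggregation_algorithm_def in1 by blast
    then obtain s1 where e1: "exec (rename_com name1 A1) s0 \<tau>1 s1" and out1: "pull name1 s1 = o1"
      and a1: "agree_off (range name1) s0 s1"
      using exec_rename[OF _ inj_name1] by blast
    \<comment> \<open>The first program writes only inside \<open>range name1\<close>, so the second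
      still finds its prepared input, including the shared \<open>alpha\<close> and
      \<open>beta\<close>.\<close>
    have in2': "pull name2 s1 = pull name2 s0"
      using a1 by (rule pull_agree_off) (use name1_neq_name2 in \<open>auto simp: eq_commute\<close>)
    have "weighted_tournament d ?w" "probability_constraints d ?w" "triangle_inequality d ?w"
      using majority_weighted_tournament majority_probability_constraints[OF S(1) ne]
        majority_triangle_inequality[OF S(1)] by auto
    then obtain \<tau>2 o2 where "exec A2 (pull name2 s1) \<tau>2 o2" and time2: "\<tau>2 \<le> t2 d"
      and L: "?F' \<noteq> {} \<Longrightarrow> approx_solution c2 ?F' (bipartition_cost d ?w) (set_output d o2)"
      using assms(4)[unfolded colorful_bipartition_algorithm_def Let_def, rule_format,
          where d = d and w = ?w and g = g and col = ?col and \<alpha> = \<alpha> and \<beta> = \<beta> and k = k] d col \<alpha> \<beta> k unfolding in2' in2 by blast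
    then obtain s2 where e2: "exec (rename_com name2 A2) s1 \<tau>2 s2" and out2: "pull name2 s2 = o2"
      and a2: "agree_off (range name2) s1 s2"
      using exec_rename[OF _ inj_name2] by blast
    have out1': "pull name1 s2 = o1"
      unfolding out1[symmetric] using a2 by (rule pull_agree_off) (use name1_neq_name2 in auto)
    have "''d'' \<notin> range name1" "''d'' \<notin> range name2"
      by (auto simp: name1_def name2_def split: if_splits)
    then have d2: "fst s2 ''d'' 0 = int d" using a1 a2 d0 by (simp add: agree_off_def)
    \<comment> \<open>This holds whether or not a feasible set exists, and it is all that the merge
      asks of the two outputs; hence the program also halts in time on infeasible instances.\<close>
    have "ranking_output d o1 \<in> rankings d" using \<sigma> by (simp add: approx_solution_def)
    then obtain \<tau>3 s3 where e3: "exec merge s2 \<tau>3 s3" and t3: "\<tau>3 \<le> 150 * (d + 1)"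
      and out: "ranking_output d s3 = promote (set_output d o2) (ranking_output d o1)"
      using exec_merge[OF d2] unfolding out1' out2 by blast
    have "exec ?A (fair_rank_aggregation_input d xs g G \<alpha> \<beta> k) (\<tau>0 + (\<tau>1 + (\<tau>2 + \<tau>3))) s3"
      by (rule exec.Seq[OF e0 exec.Seq[OF e1 exec.Seq[OF e2 e3]]])
    moreover have "\<tau>0 + (\<tau>1 + (\<tau>2 + \<tau>3)) \<le> ?T d n"
    proof -
      have "1 * d \<le> n * d\<^sup>2" using n d by (intro mult_mono) (auto simp: power2_eq_square)
      then show ?thesis using t0 time1 time2 t3 d by simp
    qed
    moreover have "?F \<noteq> {} \<longrightarrow>
        approx_solution (c1 + c2) ?F (\<lambda>\<sigma>. real (Obj S \<sigma>)) (ranking_output d s3)"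
      unfolding out
      using approx_solution_promote[OF S(1) ne G _ _ _ refl refl _ \<sigma> L] k assms(1,3) by simp
    ultimately show "let F = ?F in \<exists>\<tau> s.
        exec ?A (fair_rank_aggregation_input d xs g G \<alpha> \<beta> k) \<tau> s \<and> \<tau> \<le> ?T d n \<and>
        (F \<noteq> {} \<longrightarrow> approx_solution (c1 + c2) F (\<lambda>\<sigma>. real (Obj S \<sigma>)) (ranking_output d s))"
      unfolding Let_def by (intro exI conjI)
  qed
qed

end
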